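(* Let $\mathbf{f}:\mathbb{R}^n\to\mathbb{R}^n$ be of class $\mathcal{C}^2$, $B_d\in\mathbb{R}^{n\times m}$, let $\pi:\mathbb{R}^n\to\mathbb{R}^m$ be an $\ell$-layer ReLU feedforward neural network, and let $\mathbf{f}_{cl}(x)=\mathbf{f}(x)+B_d\pi(x)$. Let $\mathcal{Z}=CZ\{\mathbf{c},\mathbf{G},\mathbf{A},\mathbf{b}\}\subset\mathbb{R}^n$ be any constrained zonotope, with $\mathbf{G}\in\mathbb{R}^{n\times n_G}$ and $\mathbf{A}\in\mathbb{R}^{n_A\times n_G}$. Let $\pi(\mathcal{Z})=\bigcup_{i=1}^{n_\pi}CZ\{\mathbf{c}_i,\mathbf{G}_i,\mathbf{A}_i,\mathbf{b}_i\}\subset\mathbb{R}^m$ be the output set computed by the exact output analysis algorithm (described in the context) from the input $\mathcal{Z}$. Let $\hat{\mathbf{f}}(\mathcal{Z})=CZ\{\mathbf{c}_f,\mathbf{G}_f,\mathbf{A}_f,\mathbf{b}_f\}$ be computed as described in the context, from a chosen point $\gamma_x\in\Box\mathcal{Z}$ and the remainder constrained zonotope $\mathcal{R}=CZ\{\mathbf{c}_R,\mathbf{G}_R,\mathbf{A}_R,\mathbf{b}_R\}$ defined there. Let $n_{G_i}$ be the number of columns of $\mathbf{G}_i$ and $n_{G_f}$ the number of columns of $\mathbf{G}_f$. Then an over-approximated range of $\mathbf{f}_{cl}(\mathcal{Z})$ can be computed as $$\hat{\mathbf{f}}_{cl}(\mathcal{Z})=\bigcup_{i=1}^{n_\pi}CZ\{\hat{\mathbf{c}}_i^{cl},\hat{\mathbf{G}}_i^{cl},\hat{\mathbf{A}}_i^{cl},\hat{\mathbf{b}}_i^{cl}\}\supseteq\mathbf{f}_{cl}(\mathcal{Z}),$$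 where $$\hat{\mathbf{G}}_i^{cl}=\begin{bmatrix}\nabla_x^T\mathbf{f}(\gamma_x)\mathbf{G}&\mathbf{0}_{n\times(n_{G_i}-n_G)}&\mathbf{G}_R\end{bmatrix}+B_d\begin{bmatrix}\mathbf{G}_i&\mathbf{0}_{m\times(n_{G_f}-n_G)}\end{bmatrix},$$ $$\hat{\mathbf{c}}_i^{cl}=\mathbf{c}_f+B_d\mathbf{c}_i,\qquad \hat{\mathbf{A}}_i^{cl}=\begin{bmatrix}\mathbf{A}_i&\mathbf{0}\\ \mathbf{0}&\mathbf{A}_R\end{bmatrix},\qquad \hat{\mathbf{b}}_i^{cl}=\begin{bmatrix}\mathbf{b}_i\\ \mathbf{b}_R\end{bmatrix}.$$
   Context: Constrained zonotopes. For $\mathbf{c}\in\mathbb{R}^n$, $\mathbf{G}\in\mathbb{R}^{n\times n_G}$, $\mathbf{A}\in\mathbb{R}^{n_A\times n_G}$, $\mathbf{b}\in\mathbb{R}^{n_A}$, write $B_\infty(\mathbf{A},\mathbf{b})=\{\xi:\|\xi\|_\infty\le1,\ \mathbf{A}\xi=\mathbf{b}\}$ and $CZ\{\mathbf{c},\mathbf{G},\mathbf{A},\mathbf{b}\}=\{\mathbf{G}\xi+\mathbf{c}:\xi\in B_\infty(\mathbf{A},\mathbf{b})\}$. Linear images are represented by $\mathbf{M}\,CZ\{\mathbf{c},\mathbf{G},\mathbf{A},\mathbf{b}\}=CZ\{\mathbf{M}\mathbf{c},\mathbf{M}\mathbf{G},\mathbf{A},\mathbf{b}\}$. $\oplus$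 is the Minkowski sum, represented by $CZ\{\mathbf{c}_1,\mathbf{G}_1,\mathbf{A}_1,\mathbf{b}_1\}\oplus CZ\{\mathbf{c}_2,\mathbf{G}_2,\mathbf{A}_2,\mathbf{b}_2\}=CZ\{\mathbf{c}_1+\mathbf{c}_2,[\mathbf{G}_1\ \mathbf{G}_2],\mathrm{diag}(\mathbf{A}_1,\mathbf{A}_2),[\mathbf{b}_1;\mathbf{b}_2]\}$; adding a vector means translating. $\Box\mathcal{Z}$ is the interval hull (smallest axis-aligned box containing $\mathcal{Z}$). $\mathbf{f}_{cl}(\mathcal{Z})$ is the image of $\mathcal{Z}$. Network. Given weight matrices $\mathbf{W}^{(0)},\dots,\mathbf{W}^{(\ell-1)}$ and bias vectors $\mathbf{v}^{(0)},\dots,\mathbf{v}^{(\ell-1)}$ of compatible sizes, $\pi$ is defined by $x^{(0)}=x$, $x^{(k)}=\max\{0,\mathbf{W}^{(k-1)}x^{(k-1)}+\mathbf{v}^{(k-1)}\}$ (componentwise) for $k=1,\dots,\ell-1$, and $\pi(x)=\mathbf{W}^{(\ell-1)}x^{(\ell-1)}+\mathbf{v}^{(\ell-1)}$. Exact output analysis algorithm. It operates on finite unions of constrained zonotopes, each stored with its data $(\mathbf{c},\mathbf{G},\mathbf{A},\mathbf{b})$, starting from the single set $\mathcal{Z}$. For each layer $k=1,\dots,\ell-1$, with $\mathbf{W}=\mathbf{W}^{(k-1)}$, $\mathbf{v}=\mathbf{v}^{(k-1)}$, each member $CZ\{\mathbf{c},\mathbf{G},\mathbf{A},\mathbf{b}\}$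 of the current union is processed as follows, and the new union consists of all resulting pieces. (1) Set $\mathcal{I}=CZ\{\mathbf{W}\mathbf{c}+\mathbf{v},\mathbf{W}\mathbf{G},\mathbf{A},\mathbf{b}\}$, and let $[lb_i,up_i]$ be the range of the $i$-th coordinate over $\mathcal{I}$. (2) Successively for each coordinate $i$ with $lb_i<0$, replace every piece $\mathcal{I}_j$ of the current union obtained from $\mathcal{I}$ as follows. Let $\mathbf{E}_i$ be the identity matrix with its $i$-th column replaced by $0$. If $up_i\le0$, replace $\mathcal{I}_j$ by $\mathbf{E}_i\mathcal{I}_j$. If $lb_i<0$ and $up_i>0$, replace $\mathcal{I}_j$ by $(\mathcal{I}_j\cap\{x:x_i\ge0\})\cup\mathbf{E}_i(\mathcal{I}_j\cap\{x:x_i\le0\})$. In the last layer, each member $CZ\{\mathbf{c},\mathbf{G},\mathbf{A},\mathbf{b}\}$ is replaced by $CZ\{\mathbf{W}^{(\ell-1)}\mathbf{c}+\mathbf{v}^{(\ell-1)},\mathbf{W}^{(\ell-1)}\mathbf{G},\mathbf{A},\mathbf{b}\}$. The intersection of $CZ\{\mathbf{c},\mathbf{G},\mathbf{A},\mathbf{b}\}$ with a halfspace $\{x:\mathbf{h}^Tx\le f\}$ is represented as $$CZ\left\{\mathbf{c},\begin{bmatrix}\mathbf{G}&\mathbf{0}\end{bmatrix},\begin{bmatrix}\mathbf{A}&\mathbf{0}\\ \mathbf{h}^T\mathbf{G}&\frac{d_m}{2}\end{bmatrix},\begin{bmatrix}\mathbf{b}\\ f-\mathbf{h}^T\mathbf{c}-\frac{d_m}{2}\end{bmatrix}\right\},\quad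 d_m=f-\mathbf{h}^T\mathbf{c}+\sum_{r}|\mathbf{h}^T\mathbf{G}[:,r]|,$$ where $\mathbf{G}[:,r]$ is the $r$-th column; it is used with $f=0$ and $\mathbf{h}=\pm\mathbf{e}_i$, $\mathbf{e}_i$ the $i$-th canonical vector. Interval matrices. An interval matrix $[\mathbf{J}]$ has compact real intervals as entries and is identified with the set of real matrices it contains entrywise; $\mathrm{mid}$ and $\mathrm{rad}$ denote entrywise midpoint and radius (half-width). Products involving interval matrices are evaluated by interval arithmetic, and $\supseteq$ between interval matrices is entrywise. Computation of $\hat{\mathbf{f}}(\mathcal{Z})$. $\nabla_x^T\mathbf{f}(\gamma_x)$ is the Jacobian matrix of $\mathbf{f}$ at $\gamma_x$, where $\gamma_x\in\Box\mathcal{Z}$ is any chosen point. For $q=1,\dots,n$ let $\mathbf{f}_q$ be the $q$-th component of $\mathbf{f}$ and let $\mathbf{H}\mathbf{f}_q$ be the upper triangular matrix describing half of its Hessian: $\mathbf{H}_{ii}\mathbf{f}_q=\frac{\partial^2\mathbf{f}_q}{2\,\partial x_i^2}$, $\mathbf{H}_{ij}\mathbf{f}_q=\frac{\partial^2\mathbf{f}_q}{\partial x_i\partial x_j}$ for $i<j$, and $\mathbf{H}_{ij}\mathbf{f}_q=0$ for $i>j$. Let $[\mathbf{Q}^{[q]}]$ be an $n\times n$ interval matrix with $[\mathbf{Q}^{[q]}]\supseteq\mathbf{H}\mathbf{f}_q(\Box\mathcal{Z})$, let $[\tilde{\mathbf{Q}}^{[q]}]$ be an $n_G\times n_G$ interval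 matrix with $[\tilde{\mathbf{Q}}^{[q]}]\supseteq\mathbf{G}^T[\mathbf{Q}^{[q]}]\mathbf{G}$, and let $[\mathbf{L}]$ be an $n\times n$ interval matrix whose $q$-th row satisfies $[\mathbf{L}]_{q,:}\supseteq(\mathbf{c}-\gamma_x)^T[\mathbf{Q}^{[q]}]$ for all $q$. The data $\tilde{\mathbf{c}},\tilde{\mathbf{G}},\tilde{\mathbf{G}}_{\mathbf{d}},\tilde{\mathbf{A}},\tilde{\mathbf{b}}$ are as follows, with $1\le i<j\le n_G$ and $1\le r\le s\le n_A$. $\tilde{\mathbf{c}}_q=\frac12\mathrm{tr}\,\mathrm{mid}([\tilde{\mathbf{Q}}^{[q]}])$. The $q$-th row of $\tilde{\mathbf{G}}$ consists of the $n_G$ entries $\frac12\mathrm{mid}([\tilde{\mathbf{Q}}^{[q]}])_{ii}$ (for $i=1,\dots,n_G$) followed by the entries $\mathrm{mid}([\tilde{\mathbf{Q}}^{[q]}])_{ij}+\mathrm{mid}([\tilde{\mathbf{Q}}^{[q]}])_{ji}$ ($i<j$). $\tilde{\mathbf{G}}_{\mathbf{d}}$ is the $n\times n$ diagonal matrix with $q$-th diagonal entry $\sum_{k,l=1}^{n_G}\mathrm{rad}([\tilde{\mathbf{Q}}^{[q]}])_{kl}$. $\tilde{\mathbf{A}}$ has one row for each pair $r\le s$, consisting of the entries $\frac12\mathbf{A}_{ri}\mathbf{A}_{si}$ ($i=1,\dots,n_G$), followed by the entries $\mathbf{A}_{ri}\mathbf{A}_{sj}+\mathbf{A}_{rj}\mathbf{A}_{si}$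 ($i<j$, in the same order as in $\tilde{\mathbf{G}}$), followed by $n$ zeros. The corresponding entry of $\tilde{\mathbf{b}}$ is $\mathbf{b}_r\mathbf{b}_s-\frac12\sum_{i=1}^{n_G}\mathbf{A}_{ri}\mathbf{A}_{si}$. For an $n\times n$ interval matrix $[\mathbf{J}]$ and a constrained zonotope $\mathcal{Y}\subset\mathbb{R}^n$, $\triangleleft([\mathbf{J}],\mathcal{Y})$ is the following constrained zonotopic enclosure of the product $\{Jy:J\in[\mathbf{J}],y\in\mathcal{Y}\}$: with $\bar{\mathbf{c}}\oplus\bar{\mathbf{M}}\{\xi:\|\xi\|_\infty\le1\}$ a zonotope containing $\mathcal{Y}$ and $[\mathbf{m}]$ an interval vector with $[\mathbf{m}]\supseteq([\mathbf{J}]-\mathrm{mid}([\mathbf{J}]))\bar{\mathbf{c}}$ and $\mathrm{mid}([\mathbf{m}])=0$, $\triangleleft([\mathbf{J}],\mathcal{Y})=\mathrm{mid}([\mathbf{J}])\mathcal{Y}\oplus\mathbf{P}\{\xi\in\mathbb{R}^n:\|\xi\|_\infty\le1\}$, where $\mathbf{P}$ is diagonal with $\mathbf{P}_{ii}=\mathrm{rad}([\mathbf{m}])_i+\sum_j\sum_k\mathrm{rad}([\mathbf{J}])_{ik}|\bar{\mathbf{M}}_{kj}|$. Define $$\mathcal{R}=\tilde{\mathbf{c}}\oplus[\tilde{\mathbf{G}}\ \ \tilde{\mathbf{G}}_{\mathbf{d}}]B_\infty(\tilde{\mathbf{A}},\tilde{\mathbf{b}})\oplus\triangleleft\big([\mathbf{L}],(\mathbf{c}-\gamma_x)\oplus2\mathbf{G}B_\infty(\mathbf{A},\mathbf{b})\big)=CZ\{\mathbf{c}_R,\mathbf{G}_R,\mathbf{A}_R,\mathbf{b}_R\}$$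 and $\hat{\mathbf{f}}(\mathcal{Z})=\mathbf{f}(\gamma_x)\oplus\nabla_x^T\mathbf{f}(\gamma_x)(\mathcal{Z}-\gamma_x)\oplus\mathcal{R}=CZ\{\mathbf{c}_f,\mathbf{G}_f,\mathbf{A}_f,\mathbf{b}_f\}$ with $$\mathbf{c}_f=\nabla_x^T\mathbf{f}(\gamma_x)(\mathbf{c}-\gamma_x)+\mathbf{f}(\gamma_x)+\mathbf{c}_R,\quad \mathbf{G}_f=\begin{bmatrix}\nabla_x^T\mathbf{f}(\gamma_x)\mathbf{G}&\mathbf{G}_R\end{bmatrix},\quad \mathbf{A}_f=\begin{bmatrix}\mathbf{A}&\mathbf{0}\\ \mathbf{0}&\mathbf{A}_R\end{bmatrix},\quad \mathbf{b}_f=\begin{bmatrix}\mathbf{b}\\ \mathbf{b}_R\end{bmatrix}.$$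
   Formalization: As printed the claim fails (e.g. f=(x1x2,x1), Z=[-1,1]^2, γ_x=(0,1), L=0); the formal version additionally requires row q of [L] to contain (c-γ_x)^T(Hf_q(x)+Hf_q(x)^T)/2 for all x in the interval hull of Z, automatic if γ_x=c or the Hessians are diagonal. *)

theory Defs
  imports
    "HOL-Analysis.Analysis"
    "HOL-Library.Interval"
    "Jordan_Normal_Form.Matrix"
begin

hide_const (open) Finite_Cartesian_Product.vec Finite_Cartesian_Product.mat
  Finite_Cartesian_Product.row Finite_Cartesian_Product.transpose
hide_type (open) Finite_Cartesian_Product.vec
no_notation vec_nth (infixl "$" 90)

section \<open>Block matrices\<close>

definition append_cols :: "real mat \<Rightarrow> real mat \<Rightarrow> real mat" (infixr "@\<^sub>c" 65) where
  "M @\<^sub>c N = four_block_mat M N (0\<^sub>m 0 (dim_col M)) (0\<^sub>m 0 (dim_col N))"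

definition block_diag :: "real mat \<Rightarrow> real mat \<Rightarrow> real mat" where
  "block_diag M N =
     four_block_mat M (0\<^sub>m (dim_row M) (dim_col N)) (0\<^sub>m (dim_row N) (dim_col M)) N"

section \<open>Constrained zonotopes\<close>

definition B_inf :: "real mat \<Rightarrow> real vec \<Rightarrow> real vec set" where
  "B_inf A b = {\<xi> \<in> carrier_vec (dim_col A). (\<forall>i<dim_col A. \<bar>\<xi> $ i\<bar> \<le> 1) \<and> A *\<^sub>v \<xi> = b}"

text \<open>The data of a constrained zonotope; different data may denote the same set.\<close>

datatype cz = CZ (cz_c: "real vec") (cz_G: "real mat") (cz_A: "real mat") (cz_b: "real vec")

definition cz_set :: "cz \<Rightarrow> real vec set" where
  "cz_set Z = (\<lambda>\<xi>. cz_G Z *\<^sub>v \<xi> + cz_c Z) ` B_inf (cz_A Z) (cz_b Z)"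

definition cz_wf :: "nat \<Rightarrow> cz \<Rightarrow> bool" where
  "cz_wf n Z \<longleftrightarrow> cz_c Z \<in> carrier_vec n \<and> cz_G Z \<in> carrier_mat n (dim_col (cz_A Z)) \<and>
     cz_b Z \<in> carrier_vec (dim_row (cz_A Z))"

text \<open>The zonotope with center \<open>c\<close> and generators \<open>G\<close>, viewed as a constrained zonotope
  with no constraints.\<close>

definition zonotope :: "real vec \<Rightarrow> real mat \<Rightarrow> cz" where
  "zonotope c G = CZ c G (0\<^sub>m 0 (dim_col G)) (0\<^sub>v 0)"

definition cz_linear :: "real mat \<Rightarrow> cz \<Rightarrow> cz" where
  "cz_linear M Z = CZ (M *\<^sub>v cz_c Z) (M * cz_G Z) (cz_A Z) (cz_b Z)"

definition cz_affine :: "real mat \<Rightarrow> real vec \<Rightarrow> cz \<Rightarrow> cz" where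
  "cz_affine M v Z = CZ (M *\<^sub>v cz_c Z + v) (M * cz_G Z) (cz_A Z) (cz_b Z)"

definition cz_sum :: "cz \<Rightarrow> cz \<Rightarrow> cz" where
  "cz_sum Z1 Z2 = CZ (cz_c Z1 + cz_c Z2) (cz_G Z1 @\<^sub>c cz_G Z2)
     (block_diag (cz_A Z1) (cz_A Z2)) (cz_b Z1 @\<^sub>v cz_b Z2)"

text \<open>Representation of the intersection with the halfspace \<open>{x. h \<bullet> x \<le> f}\<close>.\<close>

definition cz_halfspace :: "real vec \<Rightarrow> real \<Rightarrow> cz \<Rightarrow> cz" where
  "cz_halfspace h f Z =
    (let hG = transpose_mat (cz_G Z) *\<^sub>v h;
         d = f - scalar_prod h (cz_c Z) + (\<Sum>r<dim_col (cz_G Z). \<bar>hG $ r\<bar>)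
     in CZ (cz_c Z)
           (cz_G Z @\<^sub>c 0\<^sub>m (dim_row (cz_G Z)) 1)
           (four_block_mat (cz_A Z) (0\<^sub>m (dim_row (cz_A Z)) 1)
              (mat_of_row hG) (mat 1 1 (\<lambda>_. d / 2)))
           (cz_b Z @\<^sub>v vec 1 (\<lambda>_. f - scalar_prod h (cz_c Z) - d / 2)))"

text \<open>The order on \<open>real vec\<close> is componentwise, so \<open>{l..u}\<close> is an axis-aligned box.\<close>

definition interval_hull :: "nat \<Rightarrow> real vec set \<Rightarrow> real vec set" where
  "interval_hull n S =
     \<Inter> {{l..u} | l u. l \<in> carrier_vec n \<and> u \<in> carrier_vec n \<and> S \<subseteq> {l..u}}"

section \<open>ReLU networks\<close>

definition relu :: "real vec \<Rightarrow> real vec" where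
  "relu x = map_vec (max 0) x"

primrec nn_hidden :: "(nat \<Rightarrow> real mat) \<Rightarrow> (nat \<Rightarrow> real vec) \<Rightarrow> real vec \<Rightarrow> nat \<Rightarrow> real vec" where
  "nn_hidden W v x 0 = x"
| "nn_hidden W v x (Suc k) = relu (W k *\<^sub>v nn_hidden W v x k + v k)"

definition nn :: "nat \<Rightarrow> (nat \<Rightarrow> real mat) \<Rightarrow> (nat \<Rightarrow> real vec) \<Rightarrow> real vec \<Rightarrow> real vec" where
  "nn ell W v x = W (ell - 1) *\<^sub>v nn_hidden W v x (ell - 1) + v (ell - 1)"

definition nn_wf :: "nat \<Rightarrow> nat \<Rightarrow> nat \<Rightarrow> (nat \<Rightarrow> real mat) \<Rightarrow> (nat \<Rightarrow> real vec) \<Rightarrow> bool" where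
  "nn_wf n m ell W v \<longleftrightarrow> ell \<ge> 1 \<and> (\<exists>d. d 0 = n \<and> d ell = m \<and>
     (\<forall>k<ell. W k \<in> carrier_mat (d (Suc k)) (d k) \<and> v k \<in> carrier_vec (d (Suc k))))"

section \<open>Exact output analysis\<close>

text \<open>The range of a coordinate is taken in the extended reals: on an empty set the lower bound
  is \<open>\<infinity>\<close>, so an infeasible member of the union is carried along without being processed.\<close>

definition cz_lb :: "cz \<Rightarrow> nat \<Rightarrow> ereal" where
  "cz_lb I i = (INF x\<in>cz_set I. ereal (x $ i))"

definition cz_ub :: "cz \<Rightarrow> nat \<Rightarrow> ereal" where
  "cz_ub I i = (SUP x\<in>cz_set I. ereal (x $ i))"

definition E_mat :: "nat \<Rightarrow> nat \<Rightarrow> real mat" where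
  "E_mat d i = mat d d (\<lambda>(r, s). if r = s \<and> s \<noteq> i then 1 else 0)"

text \<open>Step for coordinate \<open>i\<close> on the list of pieces obtained so far from \<open>I\<close>. The bounds are
  those of \<open>I\<close> itself, not those of the pieces.\<close>

definition relu_coord :: "cz \<Rightarrow> nat \<Rightarrow> cz list \<Rightarrow> cz list" where
  "relu_coord I i Ps =
    (let d = dim_vec (cz_c I) in
     if cz_lb I i < 0 then
       if cz_ub I i \<le> 0 then map (cz_linear (E_mat d i)) Ps
       else concat (map (\<lambda>P. [cz_halfspace (- unit_vec d i) 0 P,
                              cz_linear (E_mat d i) (cz_halfspace (unit_vec d i) 0 P)]) Ps)
     else Ps)"

definition relu_pieces :: "cz \<Rightarrow> cz list" where
  "relu_pieces I = fold (relu_coord I) [0..<dim_vec (cz_c I)] [I]"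

primrec hidden_pieces :: "(nat \<Rightarrow> real mat) \<Rightarrow> (nat \<Rightarrow> real vec) \<Rightarrow> cz \<Rightarrow> nat \<Rightarrow> cz list" where
  "hidden_pieces W v Z 0 = [Z]"
| "hidden_pieces W v Z (Suc k) =
     concat (map (\<lambda>P. relu_pieces (cz_affine (W k) (v k) P)) (hidden_pieces W v Z k))"

definition exact_output :: "nat \<Rightarrow> (nat \<Rightarrow> real mat) \<Rightarrow> (nat \<Rightarrow> real vec) \<Rightarrow> cz \<Rightarrow> cz list" where
  "exact_output ell W v Z = map (cz_affine (W (ell - 1)) (v (ell - 1))) (hidden_pieces W v Z (ell - 1))"

section \<open>Functions of class C^k, Jacobian, half Hessian\<close>

text \<open>Points of the n-dimensional space are vectors in \<open>carrier_vec n\<close>; its topology is supplied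
  by the library's \<open>Euclidean_space n\<close>, whose points are the sequences vanishing from index \<open>n\<close> on.\<close>

definition cont_Rn :: "nat \<Rightarrow> (real vec \<Rightarrow> real) \<Rightarrow> bool" where
  "cont_Rn n g \<longleftrightarrow> continuous_map (Euclidean_space n) euclideanreal (\<lambda>x. g (vec n x))"

definition has_partial :: "nat \<Rightarrow> (real vec \<Rightarrow> real) \<Rightarrow> real vec \<Rightarrow> bool" where
  "has_partial i g x \<longleftrightarrow> (\<lambda>t. g (x + t \<cdot>\<^sub>v unit_vec (dim_vec x) i)) field_differentiable (at 0)"

definition partial :: "nat \<Rightarrow> (real vec \<Rightarrow> real) \<Rightarrow> real vec \<Rightarrow> real" where
  "partial i g x = deriv (\<lambda>t. g (x + t \<cdot>\<^sub>v unit_vec (dim_vec x) i)) 0"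

primrec class_C :: "nat \<Rightarrow> nat \<Rightarrow> (real vec \<Rightarrow> real) \<Rightarrow> bool" where
  "class_C 0 n g \<longleftrightarrow> cont_Rn n g"
| "class_C (Suc k) n g \<longleftrightarrow> cont_Rn n g \<and>
     (\<forall>i<n. (\<forall>x\<in>carrier_vec n. has_partial i g x) \<and> class_C k n (partial i g))"

definition jacobian_mat :: "nat \<Rightarrow> (real vec \<Rightarrow> real vec) \<Rightarrow> real vec \<Rightarrow> real mat" where
  "jacobian_mat n f x = mat n n (\<lambda>(q, j). partial j (\<lambda>y. f y $ q) x)"

definition half_hessian :: "nat \<Rightarrow> (real vec \<Rightarrow> real vec) \<Rightarrow> nat \<Rightarrow> real vec \<Rightarrow> real mat" where
  "half_hessian n f q x = mat n n (\<lambda>(i, j).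
     if i = j then partial i (partial i (\<lambda>y. f y $ q)) x / 2
     else if i < j then partial i (partial j (\<lambda>y. f y $ q)) x
     else 0)"

section \<open>Interval matrices\<close>

text \<open>Interval matrices are of type \<open>real interval mat\<close>. On them the order \<open>\<le>\<close> is
  entrywise inclusion between matrices of the same dimensions.\<close>

definition ivl_mid :: "real interval \<Rightarrow> real" where
  "ivl_mid I = (lower I + upper I) / 2"

definition ivl_rad :: "real interval \<Rightarrow> real" where
  "ivl_rad I = width I / 2"

definition set_of_imat :: "real interval mat \<Rightarrow> real mat set" where
  "set_of_imat J = {M \<in> carrier_mat (dim_row J) (dim_col J).
     \<forall>i<dim_row J. \<forall>j<dim_col J. M $$ (i, j) \<in> set_of (J $$ (i, j))}"

abbreviation imat_of :: "real mat \<Rightarrow> real interval mat" where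
  "imat_of M \<equiv> map_mat interval_of M"

text \<open>Intervals do not form a semiring, hence the library's matrix product does not apply.\<close>

definition imat_mult :: "real interval mat \<Rightarrow> real interval mat \<Rightarrow> real interval mat"
    (infixl "*\<^sub>i" 70) where
  "M *\<^sub>i N = mat (dim_row M) (dim_col N) (\<lambda>(i, j). \<Sum>k<dim_col M. M $$ (i, k) * N $$ (k, j))"

definition imat_mult_vec :: "real interval mat \<Rightarrow> real vec \<Rightarrow> real interval vec" where
  "imat_mult_vec M x = vec (dim_row M) (\<lambda>i. \<Sum>k<dim_col M. M $$ (i, k) * interval_of (x $ k))"

text \<open>The enclosure \<open>\<triangleleft>([J], Y)\<close>. It depends on the choice of a zonotope \<open>cb \<oplus> Mb B\<close>
  containing \<open>Y\<close> and of an interval vector \<open>mv\<close>; \<open>cz_prod_ok\<close> collects the conditions on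
  these choices.\<close>

definition cz_prod_ok ::
    "nat \<Rightarrow> real interval mat \<Rightarrow> cz \<Rightarrow> real vec \<Rightarrow> real mat \<Rightarrow> real interval vec \<Rightarrow> bool" where
  "cz_prod_ok n J Y cb Mb mv \<longleftrightarrow>
     cb \<in> carrier_vec n \<and> dim_row Mb = n \<and> cz_set Y \<subseteq> cz_set (zonotope cb Mb) \<and>
     imat_mult_vec (J - imat_of (map_mat ivl_mid J)) cb \<le> mv \<and>
     map_vec ivl_mid mv = 0\<^sub>v n"

definition cz_prod :: "nat \<Rightarrow> real interval mat \<Rightarrow> cz \<Rightarrow> real mat \<Rightarrow> real interval vec \<Rightarrow> cz" where
  "cz_prod n J Y Mb mv =
     cz_sum (cz_linear (map_mat ivl_mid J) Y)
       (zonotope (0\<^sub>v n)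
         (mat_diag n (\<lambda>i. ivl_rad (mv $ i) +
            (\<Sum>j<dim_col Mb. \<Sum>k<n. ivl_rad (J $$ (i, k)) * \<bar>Mb $$ (k, j)\<bar>))))"

section \<open>The remainder and the enclosure of f\<close>

text \<open>Pairs \<open>i < j\<close> and pairs \<open>r \<le> s\<close>, in lexicographic order.\<close>

definition pairs_lt :: "nat \<Rightarrow> (nat \<times> nat) list" where
  "pairs_lt k = [(i, j). i \<leftarrow> [0..<k], j \<leftarrow> [Suc i..<k]]"

definition pairs_le :: "nat \<Rightarrow> (nat \<times> nat) list" where
  "pairs_le k = [(i, j). i \<leftarrow> [0..<k], j \<leftarrow> [i..<k]]"

definition c_tilde :: "nat \<Rightarrow> nat \<Rightarrow> (nat \<Rightarrow> real interval mat) \<Rightarrow> real vec" where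
  "c_tilde n nG Qt = vec n (\<lambda>q. (\<Sum>i<nG. ivl_mid (Qt q $$ (i, i))) / 2)"

definition G_tilde :: "nat \<Rightarrow> nat \<Rightarrow> (nat \<Rightarrow> real interval mat) \<Rightarrow> real mat" where
  "G_tilde n nG Qt =
     mat n nG (\<lambda>(q, i). ivl_mid (Qt q $$ (i, i)) / 2) @\<^sub>c
     mat n (length (pairs_lt nG)) (\<lambda>(q, k). case pairs_lt nG ! k of (i, j) \<Rightarrow>
       ivl_mid (Qt q $$ (i, j)) + ivl_mid (Qt q $$ (j, i)))"

definition G_d_tilde :: "nat \<Rightarrow> nat \<Rightarrow> (nat \<Rightarrow> real interval mat) \<Rightarrow> real mat" where
  "G_d_tilde n nG Qt = mat_diag n (\<lambda>q. \<Sum>k<nG. \<Sum>l<nG. ivl_rad (Qt q $$ (k, l)))"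

definition A_tilde :: "nat \<Rightarrow> real mat \<Rightarrow> real mat" where
  "A_tilde n A = (let nA = dim_row A; nG = dim_col A; p = length (pairs_le nA) in
     mat p nG (\<lambda>(k, i). case pairs_le nA ! k of (r, s) \<Rightarrow> A $$ (r, i) * A $$ (s, i) / 2) @\<^sub>c
     mat p (length (pairs_lt nG)) (\<lambda>(k, l). case pairs_le nA ! k of (r, s) \<Rightarrow>
       case pairs_lt nG ! l of (i, j) \<Rightarrow>
         A $$ (r, i) * A $$ (s, j) + A $$ (r, j) * A $$ (s, i)) @\<^sub>c
     0\<^sub>m p n)"

definition b_tilde :: "real mat \<Rightarrow> real vec \<Rightarrow> real vec" where
  "b_tilde A b = vec (length (pairs_le (dim_row A))) (\<lambda>k. case pairs_le (dim_row A) ! k of (r, s) \<Rightarrow>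
     b $ r * b $ s - (\<Sum>i<dim_col A. A $$ (r, i) * A $$ (s, i)) / 2)"

text \<open>The argument \<open>(c - \<gamma>) \<oplus> 2 G B_inf(A, b)\<close> of the product enclosure.\<close>

definition shifted_cz :: "real vec \<Rightarrow> cz \<Rightarrow> cz" where
  "shifted_cz \<gamma> Z = CZ (cz_c Z - \<gamma>) (2 \<cdot>\<^sub>m cz_G Z) (cz_A Z) (cz_b Z)"

text \<open>With \<open>p = c - \<gamma>\<close> the quadratic form \<open>(p + G \<xi>)\<^sup>T H (p + G \<xi>)\<close> has the cross term
  \<open>p\<^sup>T (H + H\<^sup>T) G \<xi>\<close>, while a row \<open>l\<close> of \<open>L\<close> contributes \<open>l (p + 2 G \<xi>)\<close>. As \<open>H\<close> is
  upper triangular, \<open>l = p\<^sup>T H\<close> does not reproduce it unless \<open>p = 0\<close> or \<open>H\<close> is diagonal, but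
  \<open>l = p\<^sup>T (H + H\<^sup>T) / 2\<close> does: \<open>L\<close> has to contain these rows as well.\<close>

definition remainder_cz :: "nat \<Rightarrow> cz \<Rightarrow> real vec \<Rightarrow> (nat \<Rightarrow> real interval mat) \<Rightarrow>
    real interval mat \<Rightarrow> real mat \<Rightarrow> real interval vec \<Rightarrow> cz" where
  "remainder_cz n Z \<gamma> Qt L Mb mv = (let nG = dim_col (cz_G Z) in
     cz_sum
       (CZ (c_tilde n nG Qt) (G_tilde n nG Qt @\<^sub>c G_d_tilde n nG Qt)
          (A_tilde n (cz_A Z)) (b_tilde (cz_A Z) (cz_b Z)))
       (cz_prod n L (shifted_cz \<gamma> Z) Mb mv))"

definition f_hat :: "nat \<Rightarrow> (real vec \<Rightarrow> real vec) \<Rightarrow> real vec \<Rightarrow> cz \<Rightarrow> cz \<Rightarrow> cz" where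
  "f_hat n f \<gamma> Z R =
     CZ (jacobian_mat n f \<gamma> *\<^sub>v (cz_c Z - \<gamma>) + f \<gamma> + cz_c R)
        ((jacobian_mat n f \<gamma> * cz_G Z) @\<^sub>c cz_G R)
        (block_diag (cz_A Z) (cz_A R))
        (cz_b Z @\<^sub>v cz_b R)"

text \<open>The closed-loop piece belonging to a piece \<open>P\<close> of the network output; \<open>J\<close> is the Jacobian
  of \<open>f\<close> at the chosen point, \<open>R\<close> the remainder and \<open>F\<close> the enclosure of \<open>f\<close>.\<close>

definition cl_piece :: "nat \<Rightarrow> nat \<Rightarrow> real mat \<Rightarrow> real mat \<Rightarrow> cz \<Rightarrow> cz \<Rightarrow> cz \<Rightarrow> cz \<Rightarrow> cz" where
  "cl_piece n m Bd J Z R F P =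
    (let nG = dim_col (cz_G Z); nGi = dim_col (cz_G P); nGf = dim_col (cz_G F) in
     CZ (cz_c F + Bd *\<^sub>v cz_c P)
        (((J * cz_G Z) @\<^sub>c 0\<^sub>m n (nGi - nG) @\<^sub>c cz_G R) + Bd * (cz_G P @\<^sub>c 0\<^sub>m m (nGf - nG)))
        (block_diag (cz_A P) (cz_A R))
        (cz_b P @\<^sub>v cz_b R))"

end

theory Submission
  imports Defs
begin

text \<open>Let \<open>x = G \<xi> + c\<close> be a point of \<open>Z\<close>, with \<open>\<xi> \<in> B_inf A b\<close>. The theorem holds because the
  network pieces and the linear part of \<open>f\<close> can be written with this one vector \<open>\<xi>\<close>.

  \<^emph>\<open>Network.\<close> Each operation of the exact output analysis keeps the generator variables of a piece
  and its constraints, and at most appends new ones: affine maps change only center and generators,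
  and a halfspace intersection appends one slack variable. So some output piece \<open>P\<close> represents
  \<open>\<pi>(x)\<close> by a feasible vector \<open>\<xi> @\<^sub>v \<omega>\<close> that begins with \<open>\<xi>\<close> itself (\<open>exact_output_lifts\<close>). This is
  what allows the columns of \<open>J G\<close> and the first columns of \<open>B\<^sub>d G\<^sub>i\<close> to be added: they multiply the
  same variables.

  \<^emph>\<open>Dynamics.\<close> With \<open>d = x - \<gamma>\<close>, Taylor's formula gives \<open>f(x) = f(\<gamma>) + J d + r\<close>, where
  \<open>r\<^sub>q = d\<^sup>T H d\<close> for the half Hessian \<open>H\<close> of \<open>f\<^sub>q\<close> at some point of the segment from \<open>\<gamma>\<close> to \<open>x\<close>; this point
  lies in the interval hull, which is convex. The triangular matrix \<open>H\<close> represents the full second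
  order term because mixed partial derivatives commute. Put \<open>p = c - \<gamma>\<close> and \<open>g = G \<xi>\<close>. Then
  \<open>d\<^sup>T H d = \<xi>\<^sup>T (G\<^sup>T H G) \<xi> + l (p + 2 g)\<close> with \<open>l = p\<^sup>T (H + H\<^sup>T) / 2\<close>. The first summand is an affine
  function of the monomials \<open>2 \<xi>\<^sub>i\<^sup>2 - 1\<close> and \<open>\<xi>\<^sub>i \<xi>\<^sub>j\<close>, which lie in \<open>[-1, 1]\<close> and satisfy the products of
  any two equations of \<open>A \<xi> = b\<close>; its coefficients are known up to the radii of the interval matrices,
  and replacing them by midpoints causes an error bounded by the sum of the radii
  (\<open>quadratic_part_mem\<close>). The
  second summand, over all \<open>q\<close>, is \<open>\<Lambda> y\<close> with \<open>\<Lambda>\<close> in \<open>L\<close> and \<open>y\<close> in the shifted zonotope, and is covered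
  by the product enclosure (\<open>cz_prod_mem\<close>). Together: \<open>r\<close> is a point of the remainder set.

  \<^emph>\<open>Combination.\<close> The remainder has generator variables \<open>\<eta>\<close> of its own, so \<open>(\<xi> @\<^sub>v \<omega>) @\<^sub>v \<eta>\<close> satisfies the
  block diagonal constraints of the closed-loop piece, and its image is \<open>f(x) + B\<^sub>d \<pi>(x)\<close>
  (\<open>cl_piece_mem\<close>).\<close>

section \<open>Second order Taylor expansion along segments\<close>

text \<open>Continuity in the topology of \<open>Euclidean_space n\<close>, put into the form in which the limits below
  need it: convergence of points is convergence of coordinates.\<close>

lemma cont_Rn_tendsto:
  assumes g: "cont_Rn n g" and y: "y \<in> carrier_vec n" and z: "\<And>h. z h \<in> carrier_vec n"
    and lim: "\<And>i. i < n \<Longrightarrow> ((\<lambda>h. z h $ i) \<longlongrightarrow> y $ i) F"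
  shows "((\<lambda>h. g (z h)) \<longlongrightarrow> g y) F"
proof -
  define e :: "real vec \<Rightarrow> nat \<Rightarrow> real" where "e x i = (if i < n then x $ i else 0)" for x i
  have "limitin (Euclidean_space n) (\<lambda>h. e (z h)) (e y) F"
    unfolding Euclidean_space_def limitin_subtopology limitin_componentwise
    using lim by (auto simp: e_def)
  then have "limitin euclideanreal (\<lambda>h. g (vec n (e (z h)))) (g (vec n (e y))) F"
    using continuous_map_limit[of "Euclidean_space n" euclideanreal "\<lambda>x. g (vec n x)"] g
    by (force simp: cont_Rn_def o_def)
  moreover have "vec n (e x) = x" if "x \<in> carrier_vec n" for x
    using that by (intro eq_vecI) (auto simp: e_def)
  ultimately show ?thesis using y z by simp
qed

lemma partial_derivative:
  assumes i: "i < n" and g: "\<And>x. x \<in> carrier_vec n \<Longrightarrow> has_partial i g x"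
    and y: "y \<in> carrier_vec n"
  shows "((\<lambda>t. g (y + t \<cdot>\<^sub>v unit_vec n i)) has_real_derivative
           partial i g (y + t \<cdot>\<^sub>v unit_vec n i)) (at t)"
proof -
  let ?z = "y + t \<cdot>\<^sub>v unit_vec n i"
  have z: "?z \<in> carrier_vec n" using y by simp
  have "((\<lambda>s. g (?z + s \<cdot>\<^sub>v unit_vec n i)) has_real_derivative partial i g ?z) (at 0)"
    using g[OF z] z y unfolding has_partial_def partial_def
    by (simp add: DERIV_deriv_iff_field_differentiable)
  moreover have "?z + s \<cdot>\<^sub>v unit_vec n i = y + (s + t) \<cdot>\<^sub>v unit_vec n i" for s
    using y by (intro eq_vecI) (auto simp: algebra_simps)
  ultimately show ?thesis
    using DERIV_shift[of "\<lambda>t. g (y + t \<cdot>\<^sub>v unit_vec n i)" _ 0 t] by simp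
qed

lemma partial_mvt:
  assumes i: "i < n" and g: "\<And>x. x \<in> carrier_vec n \<Longrightarrow> has_partial i g x"
    and y: "y \<in> carrier_vec n"
  shows "\<exists>\<theta>. 0 \<le> \<theta> \<and> \<theta> \<le> 1 \<and>
    g (y + h \<cdot>\<^sub>v unit_vec n i) - g y = h * partial i g (y + (\<theta> * h) \<cdot>\<^sub>v unit_vec n i)"
proof -
  have "\<exists>s>0. s < 1 \<and> g (y + (1 * h) \<cdot>\<^sub>v unit_vec n i) - g (y + (0 * h) \<cdot>\<^sub>v unit_vec n i) =
      (1 - 0) * (partial i g (y + (s * h) \<cdot>\<^sub>v unit_vec n i) * h)"
  proof (rule MVT2)
    fix s :: real
    show "((\<lambda>s. g (y + (s * h) \<cdot>\<^sub>v unit_vec n i)) has_real_derivative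
        partial i g (y + (s * h) \<cdot>\<^sub>v unit_vec n i) * h) (at s)"
      by (rule DERIV_chain2[OF partial_derivative[OF i g y]]) (auto intro!: derivative_eq_intros)
  qed auto
  moreover have "y + (0 * h) \<cdot>\<^sub>v unit_vec n i = y"
    using y by (intro eq_vecI) auto
  ultimately show ?thesis by (auto simp: mult.commute[of _ h] dest: less_imp_le)
qed

text \<open>The intermediate points supplied by the mean value theorem depend on the step \<open>h\<close> in an uncontrolled
  way; all that is known of their relative positions \<open>\<theta> h\<close> is that they lie between 0 and 1.\<close>

lemma tendsto_between_zero:
  fixes \<theta> :: "real \<Rightarrow> real"
  assumes "\<And>h. 0 \<le> \<theta> h \<and> \<theta> h \<le> 1"
  shows "((\<lambda>h. \<theta> h * h) \<longlongrightarrow> 0) (at 0 within S)"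
proof (rule Lim_null_comparison)
  show "\<forall>\<^sub>F h in at 0 within S. norm (\<theta> h * h) \<le> \<bar>h\<bar>"
    using assms by (intro always_eventually allI)
      (simp add: abs_mult mult_left_le_one_le)
  show "((\<lambda>h::real. \<bar>h\<bar>) \<longlongrightarrow> 0) (at 0 within S)"
    by (intro tendsto_rabs_zero tendsto_ident_at)
qed

text \<open>The chain rule along a line. The increment from \<open>y\<close> to \<open>y + h d\<close> is split into \<open>n\<close> steps, each along
  one coordinate axis; the mean value theorem turns each step into a value of a partial derivative
  at a point that tends to \<open>y\<close>, where the partial derivative is continuous.\<close>

lemma line_derivative_at_0:
  assumes g: "class_C 1 n g" and y: "y \<in> carrier_vec n" and d: "d \<in> carrier_vec n"
  shows "((\<lambda>t. g (y + t \<cdot>\<^sub>v d)) has_real_derivative (\<Sum>k<n. d $ k * partial k g y)) (at 0)"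
proof -
  have has: "has_partial k g x" if "k < n" "x \<in> carrier_vec n" for k x
    using g that by simp
  \<comment> \<open>\<open>z h k\<close> has the first \<open>k\<close> of the \<open>n\<close> coordinate steps carried out.\<close>
  define z where "z h k = y + vec n (\<lambda>i. if i < k then h * d $ i else 0)" for h :: real and k
  have z: "z h k \<in> carrier_vec n" for h k using y by (simp add: z_def)
  have "\<exists>\<theta>. 0 \<le> \<theta> \<and> \<theta> \<le> 1 \<and> (k < n \<longrightarrow> g (z h (Suc k)) - g (z h k) =
      h * d $ k * partial k g (z h k + (\<theta> * (h * d $ k)) \<cdot>\<^sub>v unit_vec n k))" for h k
  proof (cases "k < n")
    case True
    have "z h k + (h * d $ k) \<cdot>\<^sub>v unit_vec n k = z h (Suc k)"
      using y True by (intro eq_vecI) (auto simp: z_def less_Suc_eq)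
    with partial_mvt[OF True has[OF True] z[of h k], of "h * d $ k"] show ?thesis by auto
  qed auto
  then obtain \<theta> where \<theta>: "\<And>h k. 0 \<le> \<theta> k h \<and> \<theta> k h \<le> 1"
    and step: "\<And>h k. k < n \<Longrightarrow> g (z h (Suc k)) - g (z h k) =
      h * d $ k * partial k g (z h k + (\<theta> k h * (h * d $ k)) \<cdot>\<^sub>v unit_vec n k)"
    by metis
  define \<xi> where "\<xi> k h = z h k + (\<theta> k h * (h * d $ k)) \<cdot>\<^sub>v unit_vec n k" for k h
  have quot: "(g (y + h \<cdot>\<^sub>v d) - g y) / h = (\<Sum>k<n. d $ k * partial k g (\<xi> k h))" if "h \<noteq> 0" for h
  proof -
    have "z h n = y + h \<cdot>\<^sub>v d" "z h 0 = y"
      using y d by (auto simp: z_def intro!: eq_vecI)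
    then have "g (y + h \<cdot>\<^sub>v d) - g y = (\<Sum>k<n. g (z h (Suc k)) - g (z h k))"
      using sum_lessThan_telescope[of "\<lambda>k. g (z h k)" n] by simp
    also have "\<dots> = h * (\<Sum>k<n. d $ k * partial k g (\<xi> k h))"
      by (simp add: step \<xi>_def sum_distrib_left mult.assoc)
    finally show ?thesis using that by simp
  qed
  have "((\<lambda>h. partial k g (\<xi> k h)) \<longlongrightarrow> partial k g y) (at 0)" if k: "k < n" for k
  proof (rule cont_Rn_tendsto)
    show "cont_Rn n (partial k g)" using g k by simp
    show "\<xi> k h \<in> carrier_vec n" for h using y z by (simp add: \<xi>_def)
    fix i assume i: "i < n"
    have lim: "((\<lambda>h. if i < k then h * d $ i else 0) \<longlongrightarrow> 0) (at 0)"
      by (cases "i < k") (auto intro!: tendsto_eq_intros)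
    have "((\<lambda>h. y $ i + (if i < k then h * d $ i else 0) +
        (\<theta> k h * h) * (d $ k * (if i = k then 1 else 0))) \<longlongrightarrow> y $ i + 0 + 0 * (d $ k * (if i = k then 1 else 0))) (at 0)"
      by (intro tendsto_add tendsto_const tendsto_mult tendsto_between_zero \<theta> lim)
    then show "((\<lambda>h. \<xi> k h $ i) \<longlongrightarrow> y $ i) (at 0)"
      using i k y by (cases "i = k") (simp_all add: \<xi>_def z_def mult.assoc)
  qed (use y in auto)
  then have "((\<lambda>h. \<Sum>k<n. d $ k * partial k g (\<xi> k h)) \<longlongrightarrow> (\<Sum>k<n. d $ k * partial k g y)) (at 0)"
    by (intro tendsto_sum tendsto_mult tendsto_const) auto
  then have "((\<lambda>h. (g (y + h \<cdot>\<^sub>v d) - g y) / h) \<longlongrightarrow> (\<Sum>k<n. d $ k * partial k g y)) (at 0)"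
    by (rule Lim_transform_eventually) (auto simp: eventually_at_filter quot)
  moreover have "y + 0 \<cdot>\<^sub>v d = y" using y d by (intro eq_vecI) auto
  ultimately show ?thesis by (simp add: DERIV_def)
qed

lemma line_derivative:
  assumes g: "class_C 1 n g" and y: "y \<in> carrier_vec n" and d: "d \<in> carrier_vec n"
  shows "((\<lambda>t. g (y + t \<cdot>\<^sub>v d)) has_real_derivative
           (\<Sum>k<n. d $ k * partial k g (y + t \<cdot>\<^sub>v d))) (at t)"
proof -
  let ?z = "y + t \<cdot>\<^sub>v d"
  have "?z + s \<cdot>\<^sub>v d = y + (s + t) \<cdot>\<^sub>v d" for s
    using y d by (intro eq_vecI) (auto simp: algebra_simps)
  then show ?thesis
    using DERIV_shift[of "\<lambda>t. g (y + t \<cdot>\<^sub>v d)" _ 0 t] line_derivative_at_0[OF g _ d, of ?z] y d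
    by simp
qed

text \<open>Two applications of the mean value theorem: first along \<open>i\<close>, to the increment of \<open>g\<close> in direction \<open>j\<close>;
  then along \<open>j\<close>, to the partial derivative that results.\<close>

lemma second_difference:
  assumes g: "class_C 2 n g" and y: "y \<in> carrier_vec n" and i: "i < n" and j: "j < n"
  shows "\<exists>\<theta> \<eta>. 0 \<le> \<theta> \<and> \<theta> \<le> 1 \<and> 0 \<le> \<eta> \<and> \<eta> \<le> 1 \<and>
    g (y + h \<cdot>\<^sub>v unit_vec n i + h \<cdot>\<^sub>v unit_vec n j) - g (y + h \<cdot>\<^sub>v unit_vec n i)
      - g (y + h \<cdot>\<^sub>v unit_vec n j) + g y =
    h * h * partial j (partial i g) (y + (\<theta> * h) \<cdot>\<^sub>v unit_vec n i + (\<eta> * h) \<cdot>\<^sub>v unit_vec n j)"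
proof -
  let ?e = "unit_vec n :: nat \<Rightarrow> real vec"
  have hi: "has_partial i g x" if "x \<in> carrier_vec n" for x
    using g i that by (simp add: numeral_2_eq_2)
  have hj: "has_partial j (partial i g) x" if "x \<in> carrier_vec n" for x
    using g i j that by (simp add: numeral_2_eq_2)
  define G where "G x = g (x + h \<cdot>\<^sub>v ?e j) - g x" for x
  have comm: "y + s \<cdot>\<^sub>v ?e i + h \<cdot>\<^sub>v ?e j = y + h \<cdot>\<^sub>v ?e j + s \<cdot>\<^sub>v ?e i" for s
    using y by (intro eq_vecI) auto
  have "\<exists>s>0. s < 1 \<and> G (y + (1 * h) \<cdot>\<^sub>v ?e i) - G (y + (0 * h) \<cdot>\<^sub>v ?e i) = (1 - 0) *
    ((partial i g (y + (s * h) \<cdot>\<^sub>v ?e i + h \<cdot>\<^sub>v ?e j) - partial i g (y + (s * h) \<cdot>\<^sub>v ?e i)) * h)"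
  proof (rule MVT2)
    fix s :: real
    have "((\<lambda>t. g (y + h \<cdot>\<^sub>v ?e j + t \<cdot>\<^sub>v ?e i) - g (y + t \<cdot>\<^sub>v ?e i)) has_real_derivative
      partial i g (y + h \<cdot>\<^sub>v ?e j + (s * h) \<cdot>\<^sub>v ?e i) - partial i g (y + (s * h) \<cdot>\<^sub>v ?e i)) (at (s * h))"
      using y by (intro DERIV_diff partial_derivative i hi) auto
    then have "((\<lambda>t. G (y + t \<cdot>\<^sub>v ?e i)) has_real_derivative
      partial i g (y + (s * h) \<cdot>\<^sub>v ?e i + h \<cdot>\<^sub>v ?e j) - partial i g (y + (s * h) \<cdot>\<^sub>v ?e i)) (at (s * h))"
      by (simp add: G_def comm)
    then show "((\<lambda>s. G (y + (s * h) \<cdot>\<^sub>v ?e i)) has_real_derivative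
      (partial i g (y + (s * h) \<cdot>\<^sub>v ?e i + h \<cdot>\<^sub>v ?e j) - partial i g (y + (s * h) \<cdot>\<^sub>v ?e i)) * h) (at s)"
      by (rule DERIV_chain2) (auto intro!: derivative_eq_intros)
  qed auto
  then obtain s where s: "0 < s" "s < 1" and
    eq: "G (y + h \<cdot>\<^sub>v ?e i) - G (y + (0 * h) \<cdot>\<^sub>v ?e i) =
    (partial i g (y + (s * h) \<cdot>\<^sub>v ?e i + h \<cdot>\<^sub>v ?e j) - partial i g (y + (s * h) \<cdot>\<^sub>v ?e i)) * h"
    by auto
  have y0: "y + (0 * h) \<cdot>\<^sub>v ?e i = y"
    using y by (intro eq_vecI) auto
  obtain r where r: "0 \<le> r" "r \<le> 1" and
    "partial i g (y + (s * h) \<cdot>\<^sub>v ?e i + h \<cdot>\<^sub>v ?e j) - partial i g (y + (s * h) \<cdot>\<^sub>v ?e i) =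
      h * partial j (partial i g) (y + (s * h) \<cdot>\<^sub>v ?e i + (r * h) \<cdot>\<^sub>v ?e j)"
    using partial_mvt[OF j hj, of "y + (s * h) \<cdot>\<^sub>v ?e i" h] y by auto
  with eq have "g (y + h \<cdot>\<^sub>v ?e i + h \<cdot>\<^sub>v ?e j) - g (y + h \<cdot>\<^sub>v ?e i) - (g (y + h \<cdot>\<^sub>v ?e j) - g y) =
      h * partial j (partial i g) (y + (s * h) \<cdot>\<^sub>v ?e i + (r * h) \<cdot>\<^sub>v ?e j) * h"
    by (simp only: G_def y0)
  with s r show ?thesis
    by - (rule exI[of _ s], rule exI[of _ r], simp add: algebra_simps)
qed

text \<open>Clairaut's theorem: the second difference is symmetric in \<open>i\<close> and \<open>j\<close>, so dividing it by \<open>h\<^sup>2\<close> and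
  letting \<open>h\<close> tend to 0 yields both mixed derivatives.\<close>

lemma partial_commute:
  assumes g: "class_C 2 n g" and y: "y \<in> carrier_vec n" and i: "i < n" and j: "j < n"
  shows "partial i (partial j g) y = partial j (partial i g) y"
proof -
  let ?e = "unit_vec n :: nat \<Rightarrow> real vec"
  define Q where "Q i j h \<theta> \<eta> \<longleftrightarrow> 0 \<le> \<theta> \<and> \<theta> \<le> 1 \<and> 0 \<le> \<eta> \<and> \<eta> \<le> 1 \<and>
      g (y + h \<cdot>\<^sub>v ?e i + h \<cdot>\<^sub>v ?e j) - g (y + h \<cdot>\<^sub>v ?e i) - g (y + h \<cdot>\<^sub>v ?e j) + g y =
      h * h * partial j (partial i g) (y + (\<theta> * h) \<cdot>\<^sub>v ?e i + (\<eta> * h) \<cdot>\<^sub>v ?e j)"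
    for i j h \<theta> \<eta>
  have choose: "\<exists>\<theta> \<eta>. \<forall>h. Q i j h (\<theta> h) (\<eta> h)" if "i < n" "j < n" for i j
  proof -
    have "\<forall>h. \<exists>\<theta> \<eta>. Q i j h \<theta> \<eta>"
      unfolding Q_def using second_difference[OF g y that] by simp
    then show ?thesis by metis
  qed
  obtain \<theta> \<eta> where ij: "\<And>h. Q i j h (\<theta> h) (\<eta> h)" using choose[OF i j] by blast
  obtain \<theta>' \<eta>' where ji: "\<And>h. Q j i h (\<theta>' h) (\<eta>' h)" using choose[OF j i] by blast
  have between: "\<And>h. 0 \<le> \<theta> h \<and> \<theta> h \<le> 1" "\<And>h. 0 \<le> \<eta> h \<and> \<eta> h \<le> 1"
    "\<And>h. 0 \<le> \<theta>' h \<and> \<theta>' h \<le> 1" "\<And>h. 0 \<le> \<eta>' h \<and> \<eta>' h \<le> 1"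
    using ij ji unfolding Q_def by blast+
  have lim: "((\<lambda>h. p (y + (s h * h) \<cdot>\<^sub>v ?e a + (r h * h) \<cdot>\<^sub>v ?e b)) \<longlongrightarrow> p y) (at 0)"
    if p: "cont_Rn n p" and s: "\<And>h. 0 \<le> s h \<and> s h \<le> 1" and r: "\<And>h. 0 \<le> r h \<and> r h \<le> 1"
      and ab: "a < n" "b < n"
    for p s r a b
  proof (rule cont_Rn_tendsto[OF p y])
    fix k assume k: "k < n"
    have "((\<lambda>h. y $ k + (s h * h) * ?e a $ k + (r h * h) * ?e b $ k) \<longlongrightarrow>
        y $ k + 0 * ?e a $ k + 0 * ?e b $ k) (at 0)"
      by (intro tendsto_add tendsto_const tendsto_mult tendsto_between_zero s r)
    then show "((\<lambda>h. (y + (s h * h) \<cdot>\<^sub>v ?e a + (r h * h) \<cdot>\<^sub>v ?e b) $ k) \<longlongrightarrow> y $ k) (at 0)"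
      using k y ab by (simp add: add.assoc del: index_unit_vec(1,2))
  qed (use y in auto)
  have ji_lim: "((\<lambda>h. partial j (partial i g) (y + (\<theta> h * h) \<cdot>\<^sub>v ?e i + (\<eta> h * h) \<cdot>\<^sub>v ?e j)) \<longlongrightarrow>
      partial j (partial i g) y) (at 0)"
    using g i j by (intro lim between) (auto simp: numeral_2_eq_2)
  have "((\<lambda>h. partial i (partial j g) (y + (\<theta>' h * h) \<cdot>\<^sub>v ?e j + (\<eta>' h * h) \<cdot>\<^sub>v ?e i)) \<longlongrightarrow>
      partial i (partial j g) y) (at 0)"
    using g i j by (intro lim between) (auto simp: numeral_2_eq_2)
  moreover have "partial i (partial j g) (y + (\<theta>' h * h) \<cdot>\<^sub>v ?e j + (\<eta>' h * h) \<cdot>\<^sub>v ?e i) =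
      partial j (partial i g) (y + (\<theta> h * h) \<cdot>\<^sub>v ?e i + (\<eta> h * h) \<cdot>\<^sub>v ?e j)" if "h \<noteq> 0" for h
  proof -
    have "y + h \<cdot>\<^sub>v ?e j + h \<cdot>\<^sub>v ?e i = y + h \<cdot>\<^sub>v ?e i + h \<cdot>\<^sub>v ?e j"
      using y by (intro eq_vecI) auto
    then have "g (y + h \<cdot>\<^sub>v ?e j + h \<cdot>\<^sub>v ?e i) = g (y + h \<cdot>\<^sub>v ?e i + h \<cdot>\<^sub>v ?e j)"
      by (rule arg_cong)
    moreover have "h * h * partial i (partial j g) (y + (\<theta>' h * h) \<cdot>\<^sub>v ?e j + (\<eta>' h * h) \<cdot>\<^sub>v ?e i) =
      g (y + h \<cdot>\<^sub>v ?e j + h \<cdot>\<^sub>v ?e i) - g (y + h \<cdot>\<^sub>v ?e j) - g (y + h \<cdot>\<^sub>v ?e i) + g y"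
      using ji[of h] unfolding Q_def by (elim conjE) (rule sym)
    moreover have "h * h * partial j (partial i g) (y + (\<theta> h * h) \<cdot>\<^sub>v ?e i + (\<eta> h * h) \<cdot>\<^sub>v ?e j) =
      g (y + h \<cdot>\<^sub>v ?e i + h \<cdot>\<^sub>v ?e j) - g (y + h \<cdot>\<^sub>v ?e i) - g (y + h \<cdot>\<^sub>v ?e j) + g y"
      using ij[of h] unfolding Q_def by (elim conjE) (rule sym)
    ultimately have "h * h * partial i (partial j g) (y + (\<theta>' h * h) \<cdot>\<^sub>v ?e j + (\<eta>' h * h) \<cdot>\<^sub>v ?e i) =
      h * h * partial j (partial i g) (y + (\<theta> h * h) \<cdot>\<^sub>v ?e i + (\<eta> h * h) \<cdot>\<^sub>v ?e j)"
      by linarith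
    then show ?thesis using that by simp
  qed
  then have "\<forall>\<^sub>F h in at 0. partial i (partial j g) (y + (\<theta>' h * h) \<cdot>\<^sub>v ?e j + (\<eta>' h * h) \<cdot>\<^sub>v ?e i) =
      partial j (partial i g) (y + (\<theta> h * h) \<cdot>\<^sub>v ?e i + (\<eta> h * h) \<cdot>\<^sub>v ?e j)"
    by (auto simp: eventually_at_filter)
  ultimately have "((\<lambda>h. partial j (partial i g) (y + (\<theta> h * h) \<cdot>\<^sub>v ?e i + (\<eta> h * h) \<cdot>\<^sub>v ?e j)) \<longlongrightarrow>
      partial i (partial j g) y) (at 0)"
    by (rule Lim_transform_eventually)
  with ji_lim show ?thesis by (intro tendsto_unique[OF trivial_limit_at])
qed

text \<open>The one-dimensional formula with Lagrange remainder, applied to \<open>t \<mapsto> g (y + t d)\<close> on \<open>[0, 1]\<close>.\<close>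

lemma taylor_order_2:
  assumes g: "class_C 2 n g" and y: "y \<in> carrier_vec n" and d: "d \<in> carrier_vec n"
  shows "\<exists>t>0. t < 1 \<and> g (y + d) = g y + (\<Sum>k<n. d $ k * partial k g y) +
    (\<Sum>k<n. \<Sum>l<n. d $ k * d $ l * partial l (partial k g) (y + t \<cdot>\<^sub>v d)) / 2"
proof -
  define D where "D m t = (if m = 0 then g (y + t \<cdot>\<^sub>v d)
    else if m = 1 then \<Sum>k<n. d $ k * partial k g (y + t \<cdot>\<^sub>v d)
    else \<Sum>k<n. d $ k * (\<Sum>l<n. d $ l * partial l (partial k g) (y + t \<cdot>\<^sub>v d)))" for m :: nat and t
  have C1: "class_C 1 n g" "\<And>k. k < n \<Longrightarrow> class_C 1 n (partial k g)"
    using g by (simp_all add: numeral_2_eq_2)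
  have "(D m has_real_derivative D (Suc m) t) (at t)" if "m < 2" for m t
  proof (cases m)
    case 0
    then show ?thesis using line_derivative[OF C1(1) y d] by (simp add: D_def[abs_def])
  next
    case (Suc k)
    then have "m = 1" using that by simp
    moreover have "((\<lambda>t. \<Sum>k<n. d $ k * partial k g (y + t \<cdot>\<^sub>v d)) has_real_derivative
      (\<Sum>k<n. d $ k * (\<Sum>l<n. d $ l * partial l (partial k g) (y + t \<cdot>\<^sub>v d)))) (at t)"
      using C1(2) y d by (intro DERIV_sum DERIV_cmult line_derivative) auto
    ultimately show ?thesis by (simp add: D_def[abs_def])
  qed
  then obtain t where "0 < t" "t < 1"
    "D 0 1 = (\<Sum>m<2. D m 0 / fact m * 1 ^ m) + D 2 t / fact 2 * 1 ^ 2"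
    using Maclaurin[of 1 2 D "D 0"] by auto
  moreover have "y + 0 \<cdot>\<^sub>v d = y" using y d by (intro eq_vecI) auto
  ultimately show ?thesis
    by (intro exI[of _ t]) (auto simp: D_def numeral_2_eq_2 sum_distrib_left mult.assoc)
qed

text \<open>Used to compare triangular with full quadratic forms, and sums over the list \<open>pairs_lt\<close> with full
  double sums.\<close>

lemma double_sum_split:
  fixes a :: "nat \<Rightarrow> nat \<Rightarrow> 'a::comm_monoid_add"
  shows "(\<Sum>i<N. \<Sum>j<N. a i j) = (\<Sum>i<N. a i i) + (\<Sum>i<N. \<Sum>j\<in>{Suc i..<N}. a i j + a j i)"
proof (induction N)
  case (Suc N)
  have "(\<Sum>i<N. \<Sum>j\<in>{Suc i..<Suc N}. a i j + a j i) =
      (\<Sum>i<N. (\<Sum>j\<in>{Suc i..<N}. a i j + a j i) + (a i N + a N i))"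
    by (intro sum.cong) auto
  then show ?case using Suc by (simp add: sum.distrib ac_simps)
qed simp

text \<open>The upper triangular half Hessian has the quadratic form of half the full Hessian, because the
  entries below the diagonal equal their mirror images.\<close>

lemma quadratic_form_half_hessian:
  assumes f: "class_C 2 n (\<lambda>x. f x $ q)" and z: "z \<in> carrier_vec n"
  shows "(\<Sum>i<n. \<Sum>j<n. half_hessian n f q z $$ (i, j) * (d i * d j)) =
    (\<Sum>k<n. \<Sum>l<n. d k * d l * partial l (partial k (\<lambda>x. f x $ q)) z) / 2"
proof -
  let ?D = "\<lambda>i j. partial i (partial j (\<lambda>x. f x $ q)) z"
  have sym: "?D i j = ?D j i" if "i < n" "j < n" for i j
    using partial_commute[OF f z that] .
  have "(\<Sum>i<n. \<Sum>j<n. half_hessian n f q z $$ (i, j) * (d i * d j)) =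
      (\<Sum>i<n. ?D i i / 2 * (d i * d i)) + (\<Sum>i<n. \<Sum>j\<in>{Suc i..<n}. ?D i j * (d i * d j))"
    unfolding double_sum_split
    by (intro arg_cong2[of _ _ _ _ "(+)"] sum.cong) (auto simp: half_hessian_def)
  moreover have "(\<Sum>k<n. \<Sum>l<n. d k * d l * ?D l k) =
      (\<Sum>i<n. ?D i i * (d i * d i)) + (\<Sum>i<n. \<Sum>j\<in>{Suc i..<n}. 2 * (?D i j * (d i * d j)))"
    unfolding double_sum_split
    by (intro arg_cong2[of _ _ _ _ "(+)"] sum.cong) (auto simp: sym)
  ultimately show ?thesis
    by (simp add: sum_distrib_left[symmetric] sum_divide_distrib[symmetric] add_divide_distrib)
qed

lemma taylor_half_hessian:
  assumes f: "class_C 2 n (\<lambda>x. f x $ q)" and q: "q < n"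
    and y: "y \<in> carrier_vec n" and d: "d \<in> carrier_vec n"
  shows "\<exists>t. 0 \<le> t \<and> t \<le> 1 \<and> f (y + d) $ q = f y $ q + (jacobian_mat n f y *\<^sub>v d) $ q +
    (\<Sum>i<n. \<Sum>j<n. half_hessian n f q (y + t \<cdot>\<^sub>v d) $$ (i, j) * (d $ i * d $ j))"
proof -
  obtain t where t: "0 < t" "t < 1" "f (y + d) $ q = f y $ q +
      (\<Sum>k<n. d $ k * partial k (\<lambda>x. f x $ q) y) +
      (\<Sum>k<n. \<Sum>l<n. d $ k * d $ l * partial l (partial k (\<lambda>x. f x $ q)) (y + t \<cdot>\<^sub>v d)) / 2"
    using taylor_order_2[OF f y d] by blast
  have "(jacobian_mat n f y *\<^sub>v d) $ q = (\<Sum>k<n. d $ k * partial k (\<lambda>x. f x $ q) y)"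
    using q d by (simp add: jacobian_mat_def scalar_prod_def lessThan_atLeast0 mult.commute)
  moreover have "y + t \<cdot>\<^sub>v d \<in> carrier_vec n" using y d by simp
  ultimately show ?thesis
    using t quadratic_form_half_hessian[OF f, of "y + t \<cdot>\<^sub>v d" "\<lambda>i. d $ i"]
    by (intro exI[of _ t]) simp
qed

section \<open>Interval hulls\<close>

lemma interval_hull_least:
  "S \<subseteq> {l..u} \<Longrightarrow> l \<in> carrier_vec n \<Longrightarrow> u \<in> carrier_vec n \<Longrightarrow> interval_hull n S \<subseteq> {l..u}"
  unfolding interval_hull_def by (rule Inter_lower) blast

text \<open>Boundedness of the set matters here: without a box around the set, the hull is the intersection of an empty family, hence everything.\<close>

lemma interval_hull_carrier:
  assumes S: "S \<subseteq> {l..u}" "l \<in> carrier_vec n" "u \<in> carrier_vec n"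
    and x: "x \<in> interval_hull n S"
  shows "x \<in> carrier_vec n"
proof -
  have "x \<in> {l..u}" using interval_hull_least[OF S] x by blast
  then have "dim_vec l = dim_vec x" unfolding atLeastAtMost_iff less_eq_vec_def by blast
  then show ?thesis using carrier_vecD[OF S(2)] by (intro carrier_vecI) (rule trans[OF sym])
qed

lemma interval_hull_superset: "S \<subseteq> interval_hull n S"
  unfolding interval_hull_def by blast

lemma interval_hull_segment:
  assumes x: "x \<in> interval_hull n S" "x \<in> carrier_vec n"
    and y: "y \<in> interval_hull n S" "y \<in> carrier_vec n" and t: "0 \<le> t" "t \<le> 1"
  shows "x + t \<cdot>\<^sub>v (y - x) \<in> interval_hull n S"
  unfolding interval_hull_def
proof (rule InterI, clarify)
  fix l u :: "real vec"
  assume l: "l \<in> carrier_vec n" and u: "u \<in> carrier_vec n" and S: "S \<subseteq> {l..u}"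
  then have xy: "x \<in> {l..u}" "y \<in> {l..u}" using interval_hull_least[OF S l u] x(1) y(1) by blast+
  have "l $ i \<le> x $ i + t * (y $ i - x $ i) \<and> x $ i + t * (y $ i - x $ i) \<le> u $ i" if "i < n" for i
  proof -
    have i: "l $ i \<le> x $ i" "l $ i \<le> y $ i" "x $ i \<le> u $ i" "y $ i \<le> u $ i"
      using xy that l u x(2) y(2) by (auto simp: less_eq_vec_def)
    have "x $ i + t * (y $ i - x $ i) = (1 - t) * x $ i + t * y $ i" by (simp add: algebra_simps)
    moreover have "(1 - t) * x $ i + t * y $ i \<le> u $ i"
      using convex_bound_le[OF i(3,4), of "1 - t" t] t by simp
    moreover have "(1 - t) * (- x $ i) + t * (- y $ i) \<le> - l $ i"
      using convex_bound_le[of "- x $ i" "- l $ i" "- y $ i" "1 - t" t] i t by simp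
    ultimately show ?thesis by simp
  qed
  then show "x + t \<cdot>\<^sub>v (y - x) \<in> {l..u}"
    using l u x(2) y(2) by (auto simp: less_eq_vec_def)
qed

lemma cz_set_bounded:
  assumes wf: "cz_wf n Z"
  obtains l u where "l \<in> carrier_vec n" "u \<in> carrier_vec n" "cz_set Z \<subseteq> {l..u}"
proof -
  obtain c G A b where Z: "Z = CZ c G A b" by (cases Z)
  define k where "k = dim_col A"
  have c: "c \<in> carrier_vec n" and G: "G \<in> carrier_mat n k"
    using wf by (auto simp: cz_wf_def Z k_def)
  define s where "s i = (\<Sum>j<k. \<bar>G $$ (i, j)\<bar>)" for i
  let ?l = "vec n (\<lambda>i. c $ i - s i)" and ?u = "vec n (\<lambda>i. c $ i + s i)"
  have "x \<in> {?l..?u}" if x: "x \<in> cz_set Z" for x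
  proof -
    obtain \<xi> where \<xi>: "\<xi> \<in> B_inf A b" "x = G *\<^sub>v \<xi> + c" using x by (auto simp: cz_set_def Z)
    have \<xi>k: "\<xi> \<in> carrier_vec k" "\<And>j. j < k \<Longrightarrow> \<bar>\<xi> $ j\<bar> \<le> 1"
      using \<xi>(1) by (auto simp: B_inf_def k_def)
    have "\<bar>(G *\<^sub>v \<xi>) $ i\<bar> \<le> s i" if i: "i < n" for i
    proof -
      have "(G *\<^sub>v \<xi>) $ i = (\<Sum>j<k. G $$ (i, j) * \<xi> $ j)"
        using G \<xi>k(1) i by (simp add: scalar_prod_def lessThan_atLeast0)
      also have "\<bar>\<dots>\<bar> \<le> (\<Sum>j<k. \<bar>G $$ (i, j)\<bar> * \<bar>\<xi> $ j\<bar>)"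
        unfolding abs_mult[symmetric] by (rule sum_abs)
      also have "\<dots> \<le> s i"
        unfolding s_def using \<xi>k(2) by (intro sum_mono mult_left_le) auto
      finally show ?thesis .
    qed
    then have "c $ i - s i \<le> (G *\<^sub>v \<xi>) $ i + c $ i \<and> (G *\<^sub>v \<xi>) $ i + c $ i \<le> c $ i + s i"
      if "i < n" for i using that by (fastforce simp: abs_le_iff)
    then show ?thesis using c G by (auto simp: \<xi>(2) less_eq_vec_def)
  qed
  then show thesis by (intro that[of ?l ?u]) auto
qed

section \<open>Block matrices and sums of constrained zonotopes\<close>

lemma append_cols_carrier [simp, intro]:
  "M \<in> carrier_mat r a \<Longrightarrow> N \<in> carrier_mat r b \<Longrightarrow> M @\<^sub>c N \<in> carrier_mat r (a + b)"
  by (auto simp: append_cols_def)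

lemma append_cols_mult_vec:
  assumes "M \<in> carrier_mat r a" "N \<in> carrier_mat r b" "x \<in> carrier_vec a" "y \<in> carrier_vec b"
  shows "(M @\<^sub>c N) *\<^sub>v (x @\<^sub>v y) = M *\<^sub>v x + N *\<^sub>v y"
proof -
  have "(M @\<^sub>c N) *\<^sub>v (x @\<^sub>v y) =
      (M *\<^sub>v x + N *\<^sub>v y) @\<^sub>v (0\<^sub>m 0 a *\<^sub>v x + 0\<^sub>m 0 b *\<^sub>v y)"
    unfolding append_cols_def using assms
    by (subst four_block_mat_mult_vec[of _ r a _ b _ 0]) auto
  also have "\<dots> = M *\<^sub>v x + N *\<^sub>v y"
    using assms by (intro eq_vecI) auto
  finally show ?thesis .
qed

lemma append_cols_assoc:
  "dim_row X = dim_row Y \<Longrightarrow> dim_row Y = dim_row Z \<Longrightarrow> (X @\<^sub>c Y) @\<^sub>c Z = X @\<^sub>c (Y @\<^sub>c Z)"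
  unfolding append_cols_def by (intro eq_matI) auto

lemma block_diag_carrier [simp, intro]:
  "M \<in> carrier_mat r a \<Longrightarrow> N \<in> carrier_mat s b \<Longrightarrow> block_diag M N \<in> carrier_mat (r + s) (a + b)"
  by (auto simp: block_diag_def)

lemma block_diag_mult_vec:
  assumes M: "M \<in> carrier_mat r a" and N: "N \<in> carrier_mat s b"
    and x: "x \<in> carrier_vec a" and y: "y \<in> carrier_vec b"
  shows "block_diag M N *\<^sub>v (x @\<^sub>v y) = (M *\<^sub>v x) @\<^sub>v (N *\<^sub>v y)"
proof -
  have "block_diag M N = four_block_mat M (0\<^sub>m r b) (0\<^sub>m s a) N"
    using M N by (simp add: block_diag_def)
  then have "block_diag M N *\<^sub>v (x @\<^sub>v y) =
      (M *\<^sub>v x + 0\<^sub>m r b *\<^sub>v y) @\<^sub>v (0\<^sub>m s a *\<^sub>v x + N *\<^sub>v y)"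
    using M N x y by (simp add: four_block_mat_mult_vec[OF M _ _ N x y])
  also have "M *\<^sub>v x + 0\<^sub>m r b *\<^sub>v y = M *\<^sub>v x"
    using M y by (intro eq_vecI) auto
  also have "0\<^sub>m s a *\<^sub>v x + N *\<^sub>v y = N *\<^sub>v y"
    using N x by (intro eq_vecI) auto
  finally show ?thesis .
qed

lemma append_vec_assoc: "(x @\<^sub>v y) @\<^sub>v z = x @\<^sub>v (y @\<^sub>v z)"
  by (intro eq_vecI) auto

lemma B_inf_append:
  assumes \<xi>: "\<xi> \<in> B_inf A b" and \<eta>: "\<eta> \<in> B_inf A' b'"
  shows "\<xi> @\<^sub>v \<eta> \<in> B_inf (block_diag A A') (b @\<^sub>v b')"
proof -
  have A: "A \<in> carrier_mat (dim_row A) (dim_col A)" "A' \<in> carrier_mat (dim_row A') (dim_col A')"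
    by auto
  show ?thesis
    using \<xi> \<eta> block_diag_mult_vec[OF A] carrier_matD[OF block_diag_carrier[OF A]]
    by (auto simp: B_inf_def)
qed

lemma cz_sum_wf: "cz_wf n Z1 \<Longrightarrow> cz_wf n Z2 \<Longrightarrow> cz_wf n (cz_sum Z1 Z2)"
  by (auto simp: cz_wf_def cz_sum_def block_diag_def append_cols_def intro!: carrier_vecI carrier_matI)

lemma cz_sum_mem:
  assumes wf: "cz_wf n Z1" "cz_wf n Z2" and x: "x \<in> cz_set Z1" and y: "y \<in> cz_set Z2"
  shows "x + y \<in> cz_set (cz_sum Z1 Z2)"
proof -
  obtain \<xi> \<eta> where \<xi>: "\<xi> \<in> B_inf (cz_A Z1) (cz_b Z1)" "x = cz_G Z1 *\<^sub>v \<xi> + cz_c Z1"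
    and \<eta>: "\<eta> \<in> B_inf (cz_A Z2) (cz_b Z2)" "y = cz_G Z2 *\<^sub>v \<eta> + cz_c Z2"
    using x y by (auto simp: cz_set_def)
  define u w where "u = cz_G Z1 *\<^sub>v \<xi>" and "w = cz_G Z2 *\<^sub>v \<eta>"
  have u: "u \<in> carrier_vec n" "w \<in> carrier_vec n"
    using wf by (auto simp: cz_wf_def u_def w_def intro!: carrier_vecI)
  have "(cz_G Z1 @\<^sub>c cz_G Z2) *\<^sub>v (\<xi> @\<^sub>v \<eta>) = u + w"
    unfolding u_def w_def using wf \<xi> \<eta>
    by (intro append_cols_mult_vec[of _ n "dim_col (cz_A Z1)" _ "dim_col (cz_A Z2)"])
      (auto simp: cz_wf_def B_inf_def)
  then have "x + y = cz_G (cz_sum Z1 Z2) *\<^sub>v (\<xi> @\<^sub>v \<eta>) + cz_c (cz_sum Z1 Z2)"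
    using u wf \<xi>(2) \<eta>(2) unfolding u_def[symmetric] w_def[symmetric]
    by (intro eq_vecI) (auto simp: cz_sum_def cz_wf_def)
  then show ?thesis
    using B_inf_append[OF \<xi>(1) \<eta>(1)] by (auto simp: cz_set_def cz_sum_def)
qed

section \<open>Generator variables through affine maps and halfspaces\<close>

text \<open>The point \<open>y\<close> of \<open>P\<close> is represented by a feasible vector that begins with \<open>\<xi>\<close>. The vector \<open>\<omega>\<close> holds
  the values of the variables appended since \<open>\<xi>\<close> was chosen. This invariant is stronger than
  membership in \<open>cz_set P\<close>; it is what ties the network output to the variables of the input set.\<close>

definition lifts :: "real vec \<Rightarrow> real vec \<Rightarrow> cz \<Rightarrow> bool" where
  "lifts \<xi> y P \<longleftrightarrow>
     (\<exists>\<omega>. \<xi> @\<^sub>v \<omega> \<in> B_inf (cz_A P) (cz_b P) \<and> y = cz_G P *\<^sub>v (\<xi> @\<^sub>v \<omega>) + cz_c P)"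

lemma lifts_imp_mem: "lifts \<xi> y P \<Longrightarrow> y \<in> cz_set P"
  by (auto simp: lifts_def cz_set_def)

text \<open>Membership is the special case of an empty prefix, so statements about \<open>lifts\<close> apply to it.\<close>

lemma mem_iff_lifts_vNil: "y \<in> cz_set Z \<longleftrightarrow> lifts vNil y Z"
  by (auto simp: lifts_def cz_set_def)

lemma lifts_self:
  assumes "\<xi> \<in> B_inf A b"
  shows "lifts \<xi> (G *\<^sub>v \<xi> + c) (CZ c G A b)"
proof -
  have "\<xi> @\<^sub>v vec 0 (\<lambda>_. 0) = \<xi>" by (intro eq_vecI) auto
  then show ?thesis using assms unfolding lifts_def by (intro exI[of _ "vec 0 (\<lambda>_. 0)"]) simp
qed

lemma cz_affine_wf:
  "cz_wf d P \<Longrightarrow> M \<in> carrier_mat e d \<Longrightarrow> v \<in> carrier_vec e \<Longrightarrow> cz_wf e (cz_affine M v P)"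
  by (auto simp: cz_wf_def cz_affine_def)

lemma cz_linear_wf: "cz_wf d P \<Longrightarrow> M \<in> carrier_mat e d \<Longrightarrow> cz_wf e (cz_linear M P)"
  by (auto simp: cz_wf_def cz_linear_def)

lemma cz_linear_lifts:
  assumes wf: "cz_wf d P" and M: "M \<in> carrier_mat e d" and y: "lifts \<xi> y P"
  shows "lifts \<xi> (M *\<^sub>v y) (cz_linear M P)"
proof -
  obtain \<omega> where \<omega>: "\<xi> @\<^sub>v \<omega> \<in> B_inf (cz_A P) (cz_b P)" "y = cz_G P *\<^sub>v (\<xi> @\<^sub>v \<omega>) + cz_c P"
    using y by (auto simp: lifts_def)
  have G: "cz_G P \<in> carrier_mat d (dim_col (cz_A P))" "cz_c P \<in> carrier_vec d"
    "\<xi> @\<^sub>v \<omega> \<in> carrier_vec (dim_col (cz_A P))"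
    using wf \<omega>(1) by (auto simp: cz_wf_def B_inf_def)
  have "M *\<^sub>v y = (M * cz_G P) *\<^sub>v (\<xi> @\<^sub>v \<omega>) + M *\<^sub>v cz_c P"
    using G by (simp add: \<omega>(2) mult_add_distrib_mat_vec[OF M] assoc_mult_mat_vec[OF M])
  then show ?thesis using \<omega>(1) by (auto simp: lifts_def cz_linear_def)
qed

lemma cz_linear_mem:
  "cz_wf d P \<Longrightarrow> M \<in> carrier_mat e d \<Longrightarrow> y \<in> cz_set P \<Longrightarrow> M *\<^sub>v y \<in> cz_set (cz_linear M P)"
  unfolding mem_iff_lifts_vNil by (rule cz_linear_lifts)

lemma cz_affine_lifts:
  assumes wf: "cz_wf d P" and M: "M \<in> carrier_mat e d" and v: "v \<in> carrier_vec e"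
    and y: "lifts \<xi> y P"
  shows "lifts \<xi> (M *\<^sub>v y + v) (cz_affine M v P)"
proof -
  obtain \<omega> where \<omega>: "\<xi> @\<^sub>v \<omega> \<in> B_inf (cz_A P) (cz_b P)"
    "M *\<^sub>v y = (M * cz_G P) *\<^sub>v (\<xi> @\<^sub>v \<omega>) + M *\<^sub>v cz_c P"
    using cz_linear_lifts[OF wf M y] by (auto simp: lifts_def cz_linear_def)
  have "(M * cz_G P) *\<^sub>v (\<xi> @\<^sub>v \<omega>) \<in> carrier_vec e" "M *\<^sub>v cz_c P \<in> carrier_vec e"
    using M wf by (auto simp: cz_wf_def intro!: carrier_vecI)
  then show ?thesis using \<omega> v by (auto simp: lifts_def cz_affine_def)
qed

lemma cz_halfspace_wf: "cz_wf d P \<Longrightarrow> h \<in> carrier_vec d \<Longrightarrow> cz_wf d (cz_halfspace h f P)"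
  by (auto simp: cz_wf_def cz_halfspace_def Let_def append_cols_def intro!: carrier_vecI carrier_matI)

lemma dim_col_cz_halfspace: "dim_col (cz_A (cz_halfspace h f P)) = Suc (dim_col (cz_A P))"
  by (simp add: cz_halfspace_def Let_def)

text \<open>Intersecting with a halfspace that contains \<open>y\<close> keeps \<open>\<xi>\<close> and \<open>\<omega>\<close> and appends a slack variable \<open>\<tau>\<close>.
  The new equation says \<open>(\<tau> + 1) D / 2 = f - h \<bullet> y\<close>, where \<open>D\<close> is at least the largest value of the
  right-hand side over the unit cube; therefore \<open>\<tau>\<close> can be chosen in \<open>[-1, 1]\<close>.\<close>

lemma cz_halfspace_lifts:
  assumes wf: "cz_wf d P" and h: "h \<in> carrier_vec d" and y: "lifts \<xi> y P"
    and hy: "scalar_prod h y \<le> f"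
  shows "lifts \<xi> y (cz_halfspace h f P)"
proof -
  obtain c G A b where P: "P = CZ c G A b" by (cases P)
  obtain \<omega> where \<omega>: "\<xi> @\<^sub>v \<omega> \<in> B_inf A b" "y = G *\<^sub>v (\<xi> @\<^sub>v \<omega>) + c"
    using y by (auto simp: lifts_def P)
  define p k \<zeta> where "p = dim_row A" and "k = dim_col A" and "\<zeta> = \<xi> @\<^sub>v \<omega>"
  then have A: "A \<in> carrier_mat p k" and G: "G \<in> carrier_mat d k" and c: "c \<in> carrier_vec d"
    and b: "b \<in> carrier_vec p" and \<zeta>: "\<zeta> \<in> carrier_vec k"
    and \<zeta>1: "\<And>r. r < k \<Longrightarrow> \<bar>\<zeta> $ r\<bar> \<le> 1" and A\<zeta>: "A *\<^sub>v \<zeta> = b"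
    and y\<zeta>: "y = G *\<^sub>v \<zeta> + c"
    using wf \<omega> by (auto simp: cz_wf_def B_inf_def P)
  define hG where "hG = transpose_mat G *\<^sub>v h"
  have hG: "hG \<in> carrier_vec k" using G h by (auto simp: hG_def)
  define D where "D = f - scalar_prod h c + (\<Sum>r<k. \<bar>hG $ r\<bar>)"
  \<comment> \<open>The slack of \<open>y\<close>; its bounds \<open>0 \<le> s \<le> D\<close> are what \<open>\<tau> \<in> [-1, 1]\<close> requires.\<close>
  define s where "s = f - scalar_prod h y"
  have hG\<zeta>: "scalar_prod hG \<zeta> = scalar_prod h y - scalar_prod h c"
    using G h \<zeta> c transpose_vec_mult_scalar[OF G \<zeta> h]
    by (simp add: hG_def y\<zeta> scalar_prod_add_distrib[OF h])
  have "- scalar_prod hG \<zeta> = (\<Sum>r<k. - (hG $ r * \<zeta> $ r))"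
    using \<zeta> by (simp add: scalar_prod_def sum_negf lessThan_atLeast0)
  also have "\<dots> \<le> (\<Sum>r<k. \<bar>hG $ r\<bar>)"
  proof (rule sum_mono)
    fix r assume "r \<in> {..<k}"
    then have "\<bar>hG $ r * \<zeta> $ r\<bar> \<le> \<bar>hG $ r\<bar> * 1"
      unfolding abs_mult using \<zeta>1 by (intro mult_left_mono) auto
    then show "- (hG $ r * \<zeta> $ r) \<le> \<bar>hG $ r\<bar>" by linarith
  qed
  finally have s: "0 \<le> s" "s \<le> D"
    using hy hG\<zeta> by (auto simp: s_def D_def)
  \<comment> \<open>If \<open>D = 0\<close> then \<open>s = 0\<close>, and the new equation does not involve \<open>\<tau>\<close>.\<close>
  define \<tau> where "\<tau> = (if D = 0 then 0 else 2 * s / D - 1)"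
  have \<tau>: "\<bar>\<tau>\<bar> \<le> 1" "D / 2 * \<tau> = s - D / 2"
    using s by (auto simp: \<tau>_def abs_le_iff field_simps)
  let ?t = "vec 1 (\<lambda>_. \<tau>)"
  let ?A = "four_block_mat A (0\<^sub>m p 1) (mat_of_row hG) (mat 1 1 (\<lambda>_. D / 2))"
  let ?b = "b @\<^sub>v vec 1 (\<lambda>_. f - scalar_prod h c - D / 2)"
  have H: "cz_halfspace h f P = CZ c (G @\<^sub>c 0\<^sub>m d 1) ?A ?b"
    unfolding cz_halfspace_def Let_def D_def hG_def P cz.sel carrier_matD[OF G] carrier_matD[OF A] ..
  have "?A *\<^sub>v (\<zeta> @\<^sub>v ?t) =
      (A *\<^sub>v \<zeta> + 0\<^sub>m p 1 *\<^sub>v ?t) @\<^sub>v (mat_of_row hG *\<^sub>v \<zeta> + mat 1 1 (\<lambda>_. D / 2) *\<^sub>v ?t)"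
    using hG by (intro four_block_mat_mult_vec[where ?nr2.0 = 1, OF A _ _ _ \<zeta>]) simp_all
  also have "A *\<^sub>v \<zeta> + 0\<^sub>m p 1 *\<^sub>v ?t = b"
    using b A\<zeta> by (intro eq_vecI) auto
  also have "mat_of_row hG *\<^sub>v \<zeta> + mat 1 1 (\<lambda>_. D / 2) *\<^sub>v ?t =
      vec 1 (\<lambda>_. f - scalar_prod h c - D / 2)"
  proof (intro eq_vecI)
    have "row (mat 1 1 (\<lambda>_. D / 2)) 0 \<bullet> ?t = D / 2 * \<tau>"
      by (simp add: scalar_prod_def)
    then show "(mat_of_row hG *\<^sub>v \<zeta> + mat 1 1 (\<lambda>_. D / 2) *\<^sub>v ?t) $ i =
        vec 1 (\<lambda>_. f - scalar_prod h c - D / 2) $ i"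
      if "i < dim_vec (vec 1 (\<lambda>_. f - scalar_prod h c - D / 2))" for i
      using that hG\<zeta> \<tau>(2) by (simp add: s_def)
  qed simp
  finally have A't: "?A *\<^sub>v (\<zeta> @\<^sub>v ?t) = ?b" .
  have dim: "dim_col ?A = k + 1" using A by simp
  have "\<zeta> @\<^sub>v ?t \<in> B_inf ?A ?b"
    unfolding B_inf_def dim
  proof (intro CollectI conjI allI impI A't)
    show "\<zeta> @\<^sub>v ?t \<in> carrier_vec (k + 1)" using \<zeta> by (intro append_carrier_vec) simp_all
    show "\<bar>(\<zeta> @\<^sub>v ?t) $ r\<bar> \<le> 1" if "r < k + 1" for r
      using that \<zeta> \<zeta>1 \<tau>(1) by (cases "r < k") simp_all
  qed
  moreover have "(G @\<^sub>c 0\<^sub>m d 1) *\<^sub>v (\<zeta> @\<^sub>v ?t) = G *\<^sub>v \<zeta> + 0\<^sub>m d 1 *\<^sub>v ?t"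
    using G \<zeta> by (intro append_cols_mult_vec[of _ d k _ 1]) simp_all
  moreover have "\<dots> = G *\<^sub>v \<zeta>"
    using G by (intro eq_vecI) auto
  ultimately show ?thesis
    unfolding lifts_def H cz.sel y\<zeta> \<zeta>_def append_vec_assoc
    by (intro exI[of _ "\<omega> @\<^sub>v ?t"]) simp
qed

lemma E_mat_mult:
  assumes "y \<in> carrier_vec d"
  shows "E_mat d i *\<^sub>v y = vec d (\<lambda>j. if j = i then 0 else y $ j)"
proof (intro eq_vecI)
  fix j assume "j < dim_vec (vec d (\<lambda>j. if j = i then 0 else y $ j))"
  then have j: "j < d" by simp
  have "(E_mat d i *\<^sub>v y) $ j = (\<Sum>k\<in>{0..<d}. (if j = k \<and> k \<noteq> i then 1 else 0) * y $ k)"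
    using j assms by (simp add: E_mat_def scalar_prod_def)
  also have "\<dots> = (\<Sum>k\<in>{0..<d}. if k = j then (if j = i then 0 else y $ j) else 0)"
    by (rule sum.cong) auto
  finally have "(E_mat d i *\<^sub>v y) $ j = (if j = i then 0 else y $ j)"
    using j by simp
  then show "(E_mat d i *\<^sub>v y) $ j = vec d (\<lambda>j. if j = i then 0 else y $ j) $ j"
    using j by simp
qed (simp add: E_mat_def)

section \<open>Exact output analysis of the network\<close>

text \<open>A well-formed piece in dimension \<open>d\<close> that still has the first \<open>k\<close> generator variables. Unlike \<open>lifts\<close>
  this refers only to the data, so that it also covers pieces that represent the empty set.\<close>

definition extends :: "nat \<Rightarrow> nat \<Rightarrow> cz \<Rightarrow> bool" where
  "extends k d P \<longleftrightarrow> cz_wf d P \<and> k \<le> dim_col (cz_A P)"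

lemma relu_coord_extends:
  assumes I: "cz_wf d I" and Ps: "\<And>P. P \<in> set Ps \<Longrightarrow> extends k d P"
    and P: "P \<in> set (relu_coord I i Ps)"
  shows "extends k d P"
proof -
  have d: "dim_vec (cz_c I) = d" using I by (auto simp: cz_wf_def)
  have E: "E_mat d i \<in> carrier_mat d d" by (simp add: E_mat_def)
  have "extends k d (cz_linear (E_mat d i) X)" if "extends k d X" for X
    using that cz_linear_wf[OF _ E] by (auto simp: extends_def cz_linear_def)
  moreover have "extends k d (cz_halfspace h 0 X)" if "extends k d X" "h \<in> carrier_vec d" for X h
    using that cz_halfspace_wf by (auto simp: extends_def dim_col_cz_halfspace)
  ultimately show ?thesis
    using P Ps unfolding relu_coord_def d Let_def by (auto split: if_splits)
qed

lemma relu_fold_extends: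
  assumes I: "extends k d I" and P: "P \<in> set (fold (relu_coord I) ks [I])"
  shows "extends k d P"
  using P
proof (induction ks arbitrary: P rule: rev_induct)
  case (snoc i ks)
  have "cz_wf d I" using I by (simp add: extends_def)
  then show ?case using snoc by (auto intro: relu_coord_extends)
qed (use I in simp)

lemma relu_pieces_extends: "extends k d I \<Longrightarrow> P \<in> set (relu_pieces I) \<Longrightarrow> extends k d P"
  unfolding relu_pieces_def by (rule relu_fold_extends)

text \<open>One coordinate of the ReLU. The bounds that select the branch are those of the original set \<open>I\<close>, not of
  the piece, so the sign of \<open>y $ i\<close> is inferred from \<open>x $ i\<close>, where \<open>x\<close> is the point of \<open>I\<close> from which \<open>y\<close>
  arose and which agrees with \<open>y\<close> in the coordinate not yet processed.\<close>

lemma relu_coord_lifts: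
  assumes I: "cz_wf d I" and x: "x \<in> cz_set I" and i: "i < d"
    and P: "P \<in> set Ps" "cz_wf d P" and y: "lifts \<xi> y P" "y \<in> carrier_vec d" and yi: "y $ i = x $ i"
  shows "\<exists>P' \<in> set (relu_coord I i Ps). lifts \<xi> (vec d (\<lambda>j. if j = i then max 0 (y $ i) else y $ j)) P'"
proof -
  let ?y = "vec d (\<lambda>j. if j = i then max 0 (y $ i) else y $ j)"
  have d: "dim_vec (cz_c I) = d" using I by (auto simp: cz_wf_def)
  have E: "E_mat d i \<in> carrier_mat d d" by (simp add: E_mat_def)
  have nonneg: "?y = y" if "0 \<le> y $ i" using that y(2) by (intro eq_vecI) auto
  have nonpos: "?y = E_mat d i *\<^sub>v y" if "y $ i \<le> 0"
    using that y(2) by (intro eq_vecI) (auto simp: E_mat_mult)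
  have lb: "cz_lb I i \<le> ereal (y $ i)" and ub: "ereal (y $ i) \<le> cz_ub I i"
    unfolding cz_lb_def cz_ub_def yi using x by (auto intro: INF_lower SUP_upper)
  have unit: "scalar_prod (unit_vec d i) y = y $ i" "scalar_prod (- unit_vec d i) y = - (y $ i)"
    using i y(2) by (auto simp: scalar_prod_left_unit)
  consider (keep) "0 \<le> cz_lb I i" | (zero) "cz_lb I i < 0" "cz_ub I i \<le> 0"
    | (pos) "cz_lb I i < 0" "cz_ub I i > 0" "0 \<le> y $ i"
    | (neg) "cz_lb I i < 0" "cz_ub I i > 0" "y $ i \<le> 0"
    by (metis linorder_le_less_linear linear)
  then show ?thesis
  proof cases
    case keep
    then have "0 \<le> y $ i" using lb by (metis ereal_less_eq(5) order_trans)
    then show ?thesis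
      using keep P(1) y(1) by (auto simp: relu_coord_def Let_def nonneg)
  next
    case zero
    then have "y $ i \<le> 0" using ub by (metis ereal_less_eq(4) order_trans)
    then show ?thesis
      using zero P(1) cz_linear_lifts[OF P(2) E y(1)] by (auto simp: relu_coord_def Let_def nonpos d)
  next
    case pos
    have "lifts \<xi> y (cz_halfspace (- unit_vec d i) 0 P)"
      using pos(3) unit by (intro cz_halfspace_lifts[OF P(2) _ y(1)]) auto
    then show ?thesis
      using pos P(1) by (auto simp: relu_coord_def Let_def nonneg d)
  next
    case neg
    have "lifts \<xi> y (cz_halfspace (unit_vec d i) 0 P)"
      using neg(3) unit by (intro cz_halfspace_lifts[OF P(2) _ y(1)]) auto
    then have "lifts \<xi> (E_mat d i *\<^sub>v y) (cz_linear (E_mat d i) (cz_halfspace (unit_vec d i) 0 P))"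
      using P(2) by (intro cz_linear_lifts[OF cz_halfspace_wf E]) auto
    then show ?thesis
      using neg P(1) by (auto simp: relu_coord_def Let_def nonpos d)
  qed
qed

text \<open>Induction over the processed coordinates: after those below \<open>i\<close>, some piece holds the point whose coordinates below \<open>i\<close> are
  rectified and whose other coordinates are still those of \<open>x\<close>.\<close>

lemma relu_pieces_lifts:
  assumes I: "cz_wf d I" and x: "lifts \<xi> x I"
  shows "\<exists>P \<in> set (relu_pieces I). lifts \<xi> (relu x) P"
proof -
  have d: "dim_vec (cz_c I) = d" using I by (auto simp: cz_wf_def)
  have xd: "x \<in> carrier_vec d" using x d by (auto simp: lifts_def intro!: carrier_vecI)
  define y where "y i = vec d (\<lambda>j. if j < i then max 0 (x $ j) else x $ j)" for i
  have "\<exists>P \<in> set (fold (relu_coord I) [0..<i] [I]). lifts \<xi> (y i) P" if "i \<le> d" for i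
    using that
  proof (induction i)
    case 0
    have "y 0 = x" using xd by (intro eq_vecI) (auto simp: y_def)
    then show ?case using x by simp
  next
    case (Suc i)
    let ?Ps = "fold (relu_coord I) [0..<i] [I]"
    from Suc.prems have "i \<le> d" by simp
    then obtain P where P: "P \<in> set ?Ps" "lifts \<xi> (y i) P" using Suc.IH by blast
    have "extends 0 d P" using I by (intro relu_fold_extends[OF _ P(1)]) (simp add: extends_def)
    then have "\<exists>P' \<in> set (relu_coord I i ?Ps).
        lifts \<xi> (vec d (\<lambda>j. if j = i then max 0 (y i $ i) else y i $ j)) P'"
      using Suc.prems P by (intro relu_coord_lifts[OF I lifts_imp_mem[OF x]])
        (auto simp: y_def extends_def)
    moreover have "vec d (\<lambda>j. if j = i then max 0 (y i $ i) else y i $ j) = y (Suc i)"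
      using Suc.prems by (intro eq_vecI) (auto simp: y_def)
    ultimately show ?case by simp
  qed
  from this[of d] have "\<exists>P \<in> set (relu_pieces I). lifts \<xi> (y d) P"
    unfolding relu_pieces_def d by blast
  moreover have "y d = relu x" using xd by (intro eq_vecI) (auto simp: y_def relu_def)
  ultimately show ?thesis by simp
qed

lemma hidden_pieces_extends:
  assumes Z: "extends k (d 0) Z"
    and W: "\<And>i. i < j \<Longrightarrow> W i \<in> carrier_mat (d (Suc i)) (d i) \<and> v i \<in> carrier_vec (d (Suc i))"
    and P: "P \<in> set (hidden_pieces W v Z j)"
  shows "extends k (d j) P"
  using W P
proof (induction j arbitrary: P)
  case (Suc j)
  from Suc.prems(2) obtain P0 where P0: "P0 \<in> set (hidden_pieces W v Z j)"
    and P: "P \<in> set (relu_pieces (cz_affine (W j) (v j) P0))" by auto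
  have "extends k (d j) P0" using Suc.prems(1) P0 by (intro Suc.IH) auto
  then have "extends k (d (Suc j)) (cz_affine (W j) (v j) P0)"
    using Suc.prems(1)[of j] cz_affine_wf[of "d j" P0 "W j" _ "v j"]
    by (auto simp: extends_def) (simp add: cz_affine_def)
  then show ?case using P relu_pieces_extends by blast
qed (use Z in simp)

lemma hidden_pieces_lifts:
  assumes Z: "cz_wf (d 0) Z" and x: "lifts \<xi> x Z"
    and W: "\<And>i. i < j \<Longrightarrow> W i \<in> carrier_mat (d (Suc i)) (d i) \<and> v i \<in> carrier_vec (d (Suc i))"
  shows "\<exists>P \<in> set (hidden_pieces W v Z j). lifts \<xi> (nn_hidden W v x j) P"
  using W
proof (induction j)
  case (Suc j)
  then obtain P where P: "P \<in> set (hidden_pieces W v Z j)" "lifts \<xi> (nn_hidden W v x j) P"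
    by (meson less_SucI)
  have wf: "cz_wf (d j) P"
    using hidden_pieces_extends[of 0 d Z j W v P] Z Suc.prems P(1) by (simp add: extends_def)
  have Wj: "W j \<in> carrier_mat (d (Suc j)) (d j)" "v j \<in> carrier_vec (d (Suc j))"
    using Suc.prems by auto
  show ?case
    using relu_pieces_lifts[OF cz_affine_wf[OF wf Wj] cz_affine_lifts[OF wf Wj P(2)]] P(1) by auto
qed (use x in simp)

lemma exact_output_extends:
  assumes net: "nn_wf n m ell W v" and Z: "extends k n Z"
    and P: "P \<in> set (exact_output ell W v Z)"
  shows "extends k m P"
proof -
  obtain d where ell: "ell \<ge> 1" and d: "d 0 = n" "d ell = m"
    and W: "\<And>i. i < ell \<Longrightarrow> W i \<in> carrier_mat (d (Suc i)) (d i) \<and> v i \<in> carrier_vec (d (Suc i))"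
    using net by (auto simp: nn_wf_def)
  obtain P0 where P0: "P0 \<in> set (hidden_pieces W v Z (ell - 1))"
    and P: "P = cz_affine (W (ell - 1)) (v (ell - 1)) P0"
    using P by (auto simp: exact_output_def)
  have "extends k (d (ell - 1)) P0"
    by (rule hidden_pieces_extends[of k d Z _ W v]) (use W Z d P0 in auto)
  then show ?thesis
    using W[of "ell - 1"] ell d cz_affine_wf[of "d (ell - 1)" P0 "W (ell - 1)" m "v (ell - 1)"]
    by (auto simp: extends_def P) (simp add: cz_affine_def)
qed

lemma exact_output_lifts:
  assumes net: "nn_wf n m ell W v" and Z: "cz_wf n Z" and x: "lifts \<xi> x Z"
  shows "\<exists>P \<in> set (exact_output ell W v Z). lifts \<xi> (nn ell W v x) P"
proof -
  obtain d where ell: "ell \<ge> 1" and d: "d 0 = n" "d ell = m"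
    and W: "\<And>i. i < ell \<Longrightarrow> W i \<in> carrier_mat (d (Suc i)) (d i) \<and> v i \<in> carrier_vec (d (Suc i))"
    using net by (auto simp: nn_wf_def)
  have W': "\<And>i. i < ell - 1 \<Longrightarrow> W i \<in> carrier_mat (d (Suc i)) (d i) \<and> v i \<in> carrier_vec (d (Suc i))"
    using W by auto
  obtain P where P: "P \<in> set (hidden_pieces W v Z (ell - 1))"
    "lifts \<xi> (nn_hidden W v x (ell - 1)) P"
    using hidden_pieces_lifts[of d Z \<xi> x "ell - 1" W v] Z d x W' by auto
  have "cz_wf (d (ell - 1)) P"
    using hidden_pieces_extends[of 0 d Z "ell - 1" W v P] Z d W' P(1) by (simp add: extends_def)
  from cz_affine_lifts[OF this _ _ P(2), of "W (ell - 1)" "d ell" "v (ell - 1)"]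
  have "lifts \<xi> (nn ell W v x) (cz_affine (W (ell - 1)) (v (ell - 1)) P)"
    using W[of "ell - 1"] ell by (simp add: nn_def)
  then show ?thesis using P(1) by (auto simp: exact_output_def)
qed

section \<open>Interval matrices and the product enclosure\<close>

lemma sum_in_interval:
  fixes x :: "'b \<Rightarrow> real"
  assumes "\<And>k. k \<in> K \<Longrightarrow> x k \<in> set_of (X k)"
  shows "sum x K \<in> set_of (sum X K)"
  using assms
proof (induction K rule: infinite_finite_induct)
  case (insert k K)
  then have "x k + sum x K \<in> set_of (X k + sum X K)" by (intro plus_in_intervalI) simp_all
  then show ?case using insert.hyps by simp
qed (simp_all add: set_of_eq)

lemma set_of_mono: "X \<le> Y \<Longrightarrow> x \<in> set_of X \<Longrightarrow> (x::real) \<in> set_of Y"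
  by (auto simp: set_of_eq less_eq_interval_def)

lemma dist_ivl_mid:
  assumes "x \<in> set_of X"
  shows "\<bar>x - ivl_mid X\<bar> \<le> ivl_rad X"
proof -
  have "lower X \<le> x" "x \<le> upper X" using assms by (simp_all add: set_of_eq)
  then show ?thesis unfolding ivl_mid_def ivl_rad_def width_def by (intro abs_leI) (simp_all add: field_simps)
qed

lemma set_of_imat_mono:
  assumes "X \<le> Y" "M \<in> set_of_imat X"
  shows "M \<in> set_of_imat Y"
proof -
  have dim: "dim_row X = dim_row Y" "dim_col X = dim_col Y"
    and le: "\<And>i j. i < dim_row Y \<Longrightarrow> j < dim_col Y \<Longrightarrow> X $$ (i, j) \<le> Y $$ (i, j)"
    using assms(1) by (simp_all add: less_eq_mat_def)
  then show ?thesis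
    using assms(2) set_of_mono[OF le] unfolding set_of_imat_def dim by blast
qed

lemma imat_of_mem: "M \<in> set_of_imat (imat_of M)"
  by (simp add: set_of_imat_def in_interval_to_interval)

lemma imat_mult_mem:
  assumes M: "M \<in> set_of_imat X" and N: "N \<in> set_of_imat Y" and dim: "dim_col X = dim_row Y"
  shows "M * N \<in> set_of_imat (X *\<^sub>i Y)"
proof -
  have M': "M \<in> carrier_mat (dim_row X) (dim_col X)" and N': "N \<in> carrier_mat (dim_col X) (dim_col Y)"
    using M N dim by (simp_all add: set_of_imat_def)
  have "(M * N) $$ (i, j) \<in> set_of ((X *\<^sub>i Y) $$ (i, j))"
    if i: "i < dim_row X" and j: "j < dim_col Y" for i j
  proof -
    have "(M * N) $$ (i, j) = (\<Sum>k<dim_col X. M $$ (i, k) * N $$ (k, j))"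
      using i j M' N' by (simp add: scalar_prod_def lessThan_atLeast0)
    also have "\<dots> \<in> set_of (\<Sum>k<dim_col X. X $$ (i, k) * Y $$ (k, j))"
    proof (rule sum_in_interval)
      fix k assume "k \<in> {..<dim_col X}"
      then have "M $$ (i, k) \<in> set_of (X $$ (i, k))" "N $$ (k, j) \<in> set_of (Y $$ (k, j))"
        using i j M N dim by (simp_all add: set_of_imat_def)
      then show "M $$ (i, k) * N $$ (k, j) \<in> set_of (X $$ (i, k) * Y $$ (k, j))"
        by (rule times_in_intervalI)
    qed
    finally show ?thesis using i j by (simp add: imat_mult_def)
  qed
  then show ?thesis
    using mult_carrier_mat[OF M' N'] by (simp add: set_of_imat_def imat_mult_def)
qed

lemma imat_mult_vec_mem:
  assumes M: "M \<in> set_of_imat X" and x: "x \<in> carrier_vec (dim_col X)" and i: "i < dim_row X"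
  shows "(M *\<^sub>v x) $ i \<in> set_of (imat_mult_vec X x $ i)"
proof -
  have M': "M \<in> carrier_mat (dim_row X) (dim_col X)" using M by (simp add: set_of_imat_def)
  have "(M *\<^sub>v x) $ i = (\<Sum>k<dim_col X. M $$ (i, k) * x $ k)"
    using i M' x by (simp add: scalar_prod_def lessThan_atLeast0)
  also have "\<dots> \<in> set_of (\<Sum>k<dim_col X. X $$ (i, k) * interval_of (x $ k))"
    using M i by (intro sum_in_interval times_in_intervalI in_interval_to_interval)
      (simp_all add: set_of_imat_def)
  finally show ?thesis using i by (simp add: imat_mult_vec_def)
qed

lemma mat_diag_mult_vec:
  "x \<in> carrier_vec n \<Longrightarrow> mat_diag n \<rho> *\<^sub>v x = vec n (\<lambda>i. \<rho> i * x $ i)"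
proof (intro eq_vecI)
  fix i assume x: "x \<in> carrier_vec n" and "i < dim_vec (vec n (\<lambda>i. \<rho> i * x $ i))"
  then have i: "i < n" by simp
  have "(mat_diag n \<rho> *\<^sub>v x) $ i = (\<Sum>j\<in>{0..<n}. (if i = j then \<rho> j else 0) * x $ j)"
    using i x by (simp add: mat_diag_def scalar_prod_def)
  also have "\<dots> = (\<Sum>j\<in>{0..<n}. if j = i then \<rho> i * x $ i else 0)"
    by (rule sum.cong) auto
  finally show "(mat_diag n \<rho> *\<^sub>v x) $ i = vec n (\<lambda>i. \<rho> i * x $ i) $ i"
    using i by simp
qed (simp add: mat_diag_def)

text \<open>The solution is \<open>\<delta>\<^sub>i = z\<^sub>i / \<rho>\<^sub>i\<close>. If \<open>\<rho>\<^sub>i = 0\<close> then \<open>z\<^sub>i = 0\<close>, and the convention \<open>a / 0 = 0\<close> gives the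
  admissible value \<open>\<delta>\<^sub>i = 0\<close>.\<close>

lemma mat_diag_solve:
  fixes z :: "real vec"
  assumes z: "z \<in> carrier_vec n" and bound: "\<And>i. i < n \<Longrightarrow> \<bar>z $ i\<bar> \<le> \<rho> i"
  obtains \<delta> where "\<delta> \<in> carrier_vec n" "\<And>i. i < n \<Longrightarrow> \<bar>\<delta> $ i\<bar> \<le> 1" "mat_diag n \<rho> *\<^sub>v \<delta> = z"
proof (rule that[of "vec n (\<lambda>i. z $ i / \<rho> i)"])
  fix i assume i: "i < n"
  have "\<bar>z $ i\<bar> / \<bar>\<rho> i\<bar> \<le> 1" using bound[OF i] by (auto simp: divide_le_eq)
  then show "\<bar>vec n (\<lambda>i. z $ i / \<rho> i) $ i\<bar> \<le> 1" using i by simp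
next
  have "\<rho> i * (z $ i / \<rho> i) = z $ i" if "i < n" for i
    using bound[OF that] by (cases "\<rho> i = 0") auto
  then show "mat_diag n \<rho> *\<^sub>v vec n (\<lambda>i. z $ i / \<rho> i) = z"
    using z by (intro eq_vecI) (auto simp: mat_diag_mult_vec)
qed simp

lemma box_zonotope_mem:
  fixes z :: "real vec"
  assumes z: "z \<in> carrier_vec n" and bound: "\<And>i. i < n \<Longrightarrow> \<bar>z $ i\<bar> \<le> \<rho> i"
  shows "z \<in> cz_set (zonotope (0\<^sub>v n) (mat_diag n \<rho>))"
proof -
  obtain \<delta> where \<delta>: "\<delta> \<in> carrier_vec n" "\<And>i. i < n \<Longrightarrow> \<bar>\<delta> $ i\<bar> \<le> 1" "mat_diag n \<rho> *\<^sub>v \<delta> = z"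
    using mat_diag_solve[OF assms] by blast
  have D: "dim_col (mat_diag n \<rho>) = n" by (simp add: mat_diag_def)
  have "\<delta> \<in> B_inf (0\<^sub>m 0 n) (0\<^sub>v 0)"
    using \<delta>(1,2) by (auto simp: B_inf_def)
  then show ?thesis
    unfolding zonotope_def cz_set_def D cz.sel using \<delta>(1,3) z by (auto intro!: image_eqI[of _ _ \<delta>])
qed

lemma box_zonotope_wf: "cz_wf n (zonotope (0\<^sub>v n) (mat_diag n \<rho>))"
  by (simp add: cz_wf_def zonotope_def mat_diag_def)

lemma cz_prod_wf: "J \<in> carrier_mat n n \<Longrightarrow> cz_wf n Y \<Longrightarrow> cz_wf n (cz_prod n J Y Mb mv)"
  unfolding cz_prod_def by (intro cz_sum_wf cz_linear_wf box_zonotope_wf) auto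

text \<open>Write \<open>\<Lambda> = N + D\<close> with \<open>N\<close> the midpoint of \<open>J\<close>. Then \<open>N y\<close> lies in the linear image of \<open>Y\<close>. For \<open>D y\<close>
  represent \<open>y = Mb \<beta> + cb\<close> in the enclosing zonotope: the contribution of \<open>cb\<close> is bounded by the
  radius of \<open>mv\<close>, since \<open>mv\<close> is centered at 0, and that of \<open>Mb \<beta>\<close> by the triangle inequality.\<close>

lemma cz_prod_mem:
  assumes ok: "cz_prod_ok n J Y cb Mb mv" and J: "J \<in> carrier_mat n n" and wf: "cz_wf n Y"
    and \<Lambda>: "\<Lambda> \<in> set_of_imat J" and y: "y \<in> cz_set Y"
  shows "\<Lambda> *\<^sub>v y \<in> cz_set (cz_prod n J Y Mb mv)"
proof -
  define K where "K = dim_col Mb"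
  define N where "N = map_mat ivl_mid J"
  define D where "D = \<Lambda> - N"
  have cb: "cb \<in> carrier_vec n" and "dim_row Mb = n" and mv: "imat_mult_vec (J - imat_of N) cb \<le> mv"
    and mv0: "map_vec ivl_mid mv = 0\<^sub>v n" and Y: "cz_set Y \<subseteq> cz_set (zonotope cb Mb)"
    using ok by (simp_all add: cz_prod_ok_def N_def)
  then have Mb: "Mb \<in> carrier_mat n K" by (intro carrier_matI) (simp_all add: K_def)
  obtain \<beta> where \<beta>: "\<beta> \<in> carrier_vec K" "\<And>j. j < K \<Longrightarrow> \<bar>\<beta> $ j\<bar> \<le> 1"
    and y\<beta>: "y = Mb *\<^sub>v \<beta> + cb"
    using y Y by (auto simp: zonotope_def cz_set_def B_inf_def K_def)
  have N: "N \<in> carrier_mat n n" using J by (simp add: N_def)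
  have \<Lambda>n: "\<Lambda> \<in> carrier_mat n n" using \<Lambda> J by (simp add: set_of_imat_def)
  have D: "D \<in> carrier_mat n n" unfolding D_def by (rule minus_carrier_mat[OF N])
  have yn: "y \<in> carrier_vec n" using Mb \<beta> cb y\<beta> by simp
  have ent: "\<Lambda> $$ (i, k) \<in> set_of (J $$ (i, k))" if "i < n" "k < n" for i k
    using \<Lambda> J that by (simp add: set_of_imat_def)
  have Drad: "\<bar>D $$ (i, k)\<bar> \<le> ivl_rad (J $$ (i, k))" if "i < n" "k < n" for i k
    using dist_ivl_mid[OF ent[OF that]] that N J by (simp add: D_def N_def)
  have "D \<in> set_of_imat (J - imat_of N)"
    using N J D ent by (simp add: set_of_imat_def D_def minus_in_intervalI in_interval_to_interval)
  then have Dcb: "(D *\<^sub>v cb) $ i \<in> set_of (imat_mult_vec (J - imat_of N) cb $ i)" if "i < n" for i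
    using cb N that by (intro imat_mult_vec_mem) simp_all
  have dim_mv: "dim_vec mv = n" using arg_cong[OF mv0, of dim_vec] by simp
  have center: "\<bar>(D *\<^sub>v cb) $ i\<bar> \<le> ivl_rad (mv $ i)" if i: "i < n" for i
  proof -
    have "imat_mult_vec (J - imat_of N) cb $ i \<le> mv $ i"
      using mv dim_mv i unfolding less_eq_vec_def by simp
    then have "\<bar>(D *\<^sub>v cb) $ i - ivl_mid (mv $ i)\<bar> \<le> ivl_rad (mv $ i)"
      by (intro dist_ivl_mid set_of_mono[OF _ Dcb[OF i]])
    moreover have "ivl_mid (mv $ i) = 0"
      using arg_cong[OF mv0, of "\<lambda>w. w $ i"] i dim_mv by simp
    ultimately show ?thesis by simp
  qed
  define \<rho> where "\<rho> i = ivl_rad (mv $ i) +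
      (\<Sum>j<dim_col Mb. \<Sum>k<n. ivl_rad (J $$ (i, k)) * \<bar>Mb $$ (k, j)\<bar>)" for i
  have "D *\<^sub>v y \<in> cz_set (zonotope (0\<^sub>v n) (mat_diag n \<rho>))"
  proof (rule box_zonotope_mem)
    show "D *\<^sub>v y \<in> carrier_vec n" using D yn by simp
    fix i assume i: "i < n"
    have "(D *\<^sub>v (Mb *\<^sub>v \<beta>)) $ i = (\<Sum>k<n. D $$ (i, k) * (\<Sum>j<K. Mb $$ (k, j) * \<beta> $ j))"
      using D Mb \<beta>(1) i by (simp add: scalar_prod_def lessThan_atLeast0)
    also have "\<dots> = (\<Sum>j<K. \<Sum>k<n. D $$ (i, k) * Mb $$ (k, j) * \<beta> $ j)"
      by (subst sum.swap) (simp add: sum_distrib_left mult.assoc)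
    also have "\<bar>\<dots>\<bar> \<le> (\<Sum>j<K. \<Sum>k<n. \<bar>D $$ (i, k) * Mb $$ (k, j) * \<beta> $ j\<bar>)"
      by (intro order_trans[OF sum_abs] sum_mono sum_abs)
    also have "\<dots> \<le> (\<Sum>j<K. \<Sum>k<n. ivl_rad (J $$ (i, k)) * \<bar>Mb $$ (k, j)\<bar>)"
    proof (intro sum_mono)
      fix j k assume "j \<in> {..<K}" "k \<in> {..<n}"
      then have jk: "j < K" "k < n" by simp_all
      have "\<bar>D $$ (i, k)\<bar> * \<bar>Mb $$ (k, j)\<bar> * \<bar>\<beta> $ j\<bar> \<le> ivl_rad (J $$ (i, k)) * \<bar>Mb $$ (k, j)\<bar> * 1"
        using Drad[OF i jk(2)] \<beta>(2)[OF jk(1)] by (intro mult_mono) auto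
      then show "\<bar>D $$ (i, k) * Mb $$ (k, j) * \<beta> $ j\<bar> \<le> ivl_rad (J $$ (i, k)) * \<bar>Mb $$ (k, j)\<bar>"
        by (simp add: abs_mult)
    qed
    finally have "\<bar>(D *\<^sub>v (Mb *\<^sub>v \<beta>)) $ i\<bar> \<le> \<dots>" .
    moreover have "(D *\<^sub>v y) $ i = (D *\<^sub>v (Mb *\<^sub>v \<beta>)) $ i + (D *\<^sub>v cb) $ i"
      using i D Mb \<beta>(1) cb by (simp add: y\<beta> mult_add_distrib_mat_vec[OF D])
    ultimately show "\<bar>(D *\<^sub>v y) $ i\<bar> \<le> \<rho> i"
      using center[OF i] unfolding \<rho>_def K_def[symmetric] by linarith
  qed
  moreover have "N *\<^sub>v y \<in> cz_set (cz_linear N Y)"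
    using wf N y by (rule cz_linear_mem)
  ultimately have "N *\<^sub>v y + D *\<^sub>v y \<in> cz_set (cz_prod n J Y Mb mv)"
    unfolding cz_prod_def N_def[symmetric] \<rho>_def[symmetric]
    by (intro cz_sum_mem[of n] cz_linear_wf[OF wf N] box_zonotope_wf)
  moreover have "N *\<^sub>v y + D *\<^sub>v y = \<Lambda> *\<^sub>v y"
  proof -
    have "N + D = \<Lambda>" using N \<Lambda>n by (intro eq_matI) (auto simp: D_def)
    then show ?thesis using add_mult_distrib_mat_vec[OF N D yn] by simp
  qed
  ultimately show ?thesis by simp
qed

section \<open>Linearization of the quadratic form by monomials\<close>

lemma sum_list_concat: "sum_list (concat xss) = sum_list (map sum_list xss)"
  by (induction xss) simp_all

lemma sum_pairs_lt:
  "(\<Sum>k<length (pairs_lt N). case pairs_lt N ! k of (i, j) \<Rightarrow> F i j) =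
    (\<Sum>i<N. \<Sum>j\<in>{Suc i..<N}. F i j)"
proof -
  have "(\<Sum>k<length (pairs_lt N). case pairs_lt N ! k of (i, j) \<Rightarrow> F i j) =
      sum_list (map (case_prod F) (pairs_lt N))"
    by (simp add: sum_list_sum_nth lessThan_atLeast0)
  also have "\<dots> = sum_list (map (\<lambda>i. sum_list (map (F i) [Suc i..<N])) [0..<N])"
    by (simp add: pairs_lt_def map_concat sum_list_concat o_def)
  also have "\<dots> = (\<Sum>i<N. \<Sum>j\<in>{Suc i..<N}. F i j)"
    by (simp add: interv_sum_list_conv_sum_set_nat lessThan_atLeast0)
  finally show ?thesis .
qed

lemma pairs_le_nth:
  assumes "k < length (pairs_le N)"
  obtains r s where "pairs_le N ! k = (r, s)" "r < N" "s < N"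
proof -
  have "pairs_le N ! k \<in> set (pairs_le N)" using assms by (rule nth_mem)
  then show thesis by (auto simp: pairs_le_def intro: that)
qed

text \<open>The monomials of degree two in \<open>\<xi>\<close>, with squares mapped affinely from \<open>[0, 1]\<close> onto \<open>[-1, 1]\<close>. The
  order is that of the columns of \<open>G_tilde\<close> and \<open>A_tilde\<close>.\<close>

definition quad_vars :: "nat \<Rightarrow> real vec \<Rightarrow> real vec" where
  "quad_vars N \<xi> = vec N (\<lambda>i. 2 * (\<xi> $ i * \<xi> $ i) - 1) @\<^sub>v
     vec (length (pairs_lt N)) (\<lambda>k. case pairs_lt N ! k of (i, j) \<Rightarrow> \<xi> $ i * \<xi> $ j)"

lemma quad_vars_bounded:
  assumes \<xi>: "\<And>i. i < N \<Longrightarrow> \<bar>\<xi> $ i\<bar> \<le> 1" and k: "k < dim_vec (quad_vars N \<xi>)"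
  shows "\<bar>quad_vars N \<xi> $ k\<bar> \<le> 1"
proof -
  have prod: "\<bar>\<xi> $ i * \<xi> $ j\<bar> \<le> 1" if "i < N" "j < N" for i j
    unfolding abs_mult using \<xi>[OF that(1)] \<xi>[OF that(2)] by (intro mult_le_one) auto
  show ?thesis
  proof (cases "k < N")
    case True
    have "0 \<le> \<xi> $ k * \<xi> $ k" by simp
    with prod[OF True True] True show ?thesis by (simp add: quad_vars_def abs_le_iff)
  next
    case False
    define l where "l = k - N"
    have l: "l < length (pairs_lt N)" using k False by (simp add: l_def quad_vars_def)
    then have "pairs_lt N ! l \<in> set (pairs_lt N)" by (rule nth_mem)
    then obtain i j where "pairs_lt N ! l = (i, j)" "i < N" "j < N"
      by (auto simp: pairs_lt_def)
    then show ?thesis using prod False k l by (simp add: quad_vars_def l_def)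
  qed
qed

text \<open>The matrices \<open>G_tilde\<close> and \<open>A_tilde\<close> have the same shape: row \<open>k\<close> consists of the coefficients of a
  bilinear form \<open>a k\<close>, halved on the diagonal and symmetrized off it. Applied to \<open>quad_vars\<close> such a row
  yields the quadratic form up to the constant that comes from \<open>\<xi>\<^sub>i\<^sup>2 = (2 \<xi>\<^sub>i\<^sup>2 - 1) / 2 + 1 / 2\<close>.\<close>

lemma quad_vars_row:
  assumes M: "M = mat p N (\<lambda>(k, i). a k i i / 2) @\<^sub>c
      mat p (length (pairs_lt N)) (\<lambda>(k, l). case pairs_lt N ! l of (i, j) \<Rightarrow> a k i j + a k j i)"
    and \<xi>: "\<xi> \<in> carrier_vec N" and k: "k < p"
  shows "(M *\<^sub>v quad_vars N \<xi>) $ k =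
    (\<Sum>i<N. \<Sum>j<N. a k i j * (\<xi> $ i * \<xi> $ j)) - (\<Sum>i<N. a k i i) / 2"
proof -
  let ?P = "length (pairs_lt N)"
  let ?u = "vec N (\<lambda>i. 2 * (\<xi> $ i * \<xi> $ i) - 1)"
  let ?w = "vec ?P (\<lambda>k. case pairs_lt N ! k of (i, j) \<Rightarrow> \<xi> $ i * \<xi> $ j)"
  let ?M1 = "mat p N (\<lambda>(k, i). a k i i / 2)"
  let ?M2 = "mat p ?P (\<lambda>(k, l). case pairs_lt N ! l of (i, j) \<Rightarrow> a k i j + a k j i)"
  have "M *\<^sub>v quad_vars N \<xi> = ?M1 *\<^sub>v ?u + ?M2 *\<^sub>v ?w"
    unfolding M quad_vars_def by (rule append_cols_mult_vec[where r = p and a = N and b = ?P]) simp_all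
  moreover have "(?M1 *\<^sub>v ?u) $ k = (\<Sum>i<N. a k i i * (\<xi> $ i * \<xi> $ i)) - (\<Sum>i<N. a k i i) / 2"
    using k by (simp add: scalar_prod_def lessThan_atLeast0 sum_divide_distrib
      sum_subtractf[symmetric] algebra_simps)
  moreover have "(?M2 *\<^sub>v ?w) $ k =
      (\<Sum>i<N. \<Sum>j\<in>{Suc i..<N}. (a k i j + a k j i) * (\<xi> $ i * \<xi> $ j))"
  proof -
    have "(?M2 *\<^sub>v ?w) $ k = (\<Sum>l<?P. case pairs_lt N ! l of (i, j) \<Rightarrow>
        (a k i j + a k j i) * (\<xi> $ i * \<xi> $ j))"
      using k by (simp add: scalar_prod_def lessThan_atLeast0 split_beta)
    then show ?thesis by (simp only: sum_pairs_lt)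
  qed
  moreover have "(\<Sum>i<N. \<Sum>j<N. a k i j * (\<xi> $ i * \<xi> $ j)) =
      (\<Sum>i<N. a k i i * (\<xi> $ i * \<xi> $ i)) +
      (\<Sum>i<N. \<Sum>j\<in>{Suc i..<N}. (a k i j + a k j i) * (\<xi> $ i * \<xi> $ j))"
    unfolding double_sum_split[of _ N]
    by (intro arg_cong2[of _ _ _ _ "(+)"] sum.cong) (simp_all add: algebra_simps)
  ultimately show ?thesis using k by simp
qed

lemma quadratic_part_wf:
  assumes "A \<in> carrier_mat nA N"
  shows "cz_wf n (CZ (c_tilde n N Qt) (G_tilde n N Qt @\<^sub>c G_d_tilde n N Qt) (A_tilde n A) (b_tilde A b))"
  using assms
  by (auto simp: cz_wf_def c_tilde_def G_tilde_def G_d_tilde_def A_tilde_def b_tilde_def Let_def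
      append_cols_def mat_diag_def)

text \<open>The monomials in \<open>\<xi>\<close> serve as generator variables. They reproduce the part of the quadratic form that
  belongs to the interval midpoints; the deviation from the midpoints is absorbed by the \<open>n\<close> variables of
  \<open>G_d_tilde\<close>, since every monomial is bounded by 1. The constraint for rows \<open>r\<close> and \<open>s\<close> is the product of
  the equations \<open>(A \<xi>)\<^sub>r = b\<^sub>r\<close> and \<open>(A \<xi>)\<^sub>s = b\<^sub>s\<close>, in which the diagonal constant reappears.\<close>

lemma quadratic_part_mem:
  assumes A: "A \<in> carrier_mat nA N" and b: "b \<in> carrier_vec nA" and \<xi>: "\<xi> \<in> B_inf A b"
    and M: "\<And>q i j. q < n \<Longrightarrow> i < N \<Longrightarrow> j < N \<Longrightarrow> M q $$ (i, j) \<in> set_of (Qt q $$ (i, j))"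
  shows "vec n (\<lambda>q. \<Sum>i<N. \<Sum>j<N. M q $$ (i, j) * (\<xi> $ i * \<xi> $ j)) \<in>
    cz_set (CZ (c_tilde n N Qt) (G_tilde n N Qt @\<^sub>c G_d_tilde n N Qt) (A_tilde n A) (b_tilde A b))"
proof -
  let ?P = "length (pairs_lt N)" and ?p = "length (pairs_le nA)" and ?\<eta> = "quad_vars N \<xi>"
  have \<xi>N: "\<xi> \<in> carrier_vec N" and \<xi>1: "\<And>i. i < N \<Longrightarrow> \<bar>\<xi> $ i\<bar> \<le> 1" and A\<xi>: "A *\<^sub>v \<xi> = b"
    using \<xi> A by (auto simp: B_inf_def)
  have \<eta>: "?\<eta> \<in> carrier_vec (N + ?P)"
    unfolding quad_vars_def by (intro append_carrier_vec) simp_all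
  define z where "z = vec n (\<lambda>q. \<Sum>i<N. \<Sum>j<N. (M q $$ (i, j) - ivl_mid (Qt q $$ (i, j))) * (\<xi> $ i * \<xi> $ j))"
  obtain \<delta> where \<delta>: "\<delta> \<in> carrier_vec n" "\<And>q. q < n \<Longrightarrow> \<bar>\<delta> $ q\<bar> \<le> 1" "G_d_tilde n N Qt *\<^sub>v \<delta> = z"
    unfolding G_d_tilde_def
  proof (rule mat_diag_solve)
    show "z \<in> carrier_vec n" by (simp add: z_def)
    fix q assume q: "q < n"
    have "\<bar>z $ q\<bar> \<le> (\<Sum>i<N. \<Sum>j<N. \<bar>(M q $$ (i, j) - ivl_mid (Qt q $$ (i, j))) * (\<xi> $ i * \<xi> $ j)\<bar>)"
      using q unfolding z_def by (simp, intro order_trans[OF sum_abs] sum_mono sum_abs)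
    also have "\<dots> \<le> (\<Sum>i<N. \<Sum>j<N. ivl_rad (Qt q $$ (i, j)))"
    proof (intro sum_mono)
      fix i j assume "i \<in> {..<N}" "j \<in> {..<N}"
      then have ij: "i < N" "j < N" by simp_all
      have "\<bar>\<xi> $ i\<bar> * \<bar>\<xi> $ j\<bar> \<le> 1" using \<xi>1 ij by (intro mult_le_one) auto
      then have "\<bar>M q $$ (i, j) - ivl_mid (Qt q $$ (i, j))\<bar> * (\<bar>\<xi> $ i\<bar> * \<bar>\<xi> $ j\<bar>)
          \<le> ivl_rad (Qt q $$ (i, j)) * 1"
        using dist_ivl_mid[OF M[OF q ij]] by (intro mult_mono) auto
      then show "\<bar>(M q $$ (i, j) - ivl_mid (Qt q $$ (i, j))) * (\<xi> $ i * \<xi> $ j)\<bar> \<le> ivl_rad (Qt q $$ (i, j))"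
        by (simp add: abs_mult)
    qed
    finally show "\<bar>z $ q\<bar> \<le> (\<Sum>i<N. \<Sum>j<N. ivl_rad (Qt q $$ (i, j)))" .
  qed blast
  have G: "G_tilde n N Qt \<in> carrier_mat n (N + ?P)" "G_d_tilde n N Qt \<in> carrier_mat n n"
    unfolding G_tilde_def G_d_tilde_def by (intro append_cols_carrier mat_carrier mat_diag_dim)+
  have point: "vec n (\<lambda>q. \<Sum>i<N. \<Sum>j<N. M q $$ (i, j) * (\<xi> $ i * \<xi> $ j)) =
      (G_tilde n N Qt @\<^sub>c G_d_tilde n N Qt) *\<^sub>v (?\<eta> @\<^sub>v \<delta>) + c_tilde n N Qt"
  proof (intro eq_vecI)
    fix q assume "q < dim_vec ((G_tilde n N Qt @\<^sub>c G_d_tilde n N Qt) *\<^sub>v (?\<eta> @\<^sub>v \<delta>) + c_tilde n N Qt)"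
    then have q: "q < n" by (simp add: c_tilde_def)
    have "(G_tilde n N Qt *\<^sub>v ?\<eta>) $ q =
        (\<Sum>i<N. \<Sum>j<N. ivl_mid (Qt q $$ (i, j)) * (\<xi> $ i * \<xi> $ j)) - (\<Sum>i<N. ivl_mid (Qt q $$ (i, i))) / 2"
      by (rule quad_vars_row[OF G_tilde_def \<xi>N q])
    then show "vec n (\<lambda>q. \<Sum>i<N. \<Sum>j<N. M q $$ (i, j) * (\<xi> $ i * \<xi> $ j)) $ q =
        ((G_tilde n N Qt @\<^sub>c G_d_tilde n N Qt) *\<^sub>v (?\<eta> @\<^sub>v \<delta>) + c_tilde n N Qt) $ q"
      using q carrier_matD[OF G(1)] unfolding append_cols_mult_vec[OF G \<eta> \<delta>(1)] \<delta>(3)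
      by (simp add: z_def c_tilde_def sum.distrib[symmetric] distrib_right[symmetric])
  qed (simp add: c_tilde_def)
  \<comment> \<open>Row \<open>k\<close> of \<open>A_tilde\<close> is the bilinear form given by the product of two rows of \<open>A\<close>.\<close>
  define a where "a k i j = (case pairs_le nA ! k of (r, s) \<Rightarrow> A $$ (r, i) * A $$ (s, j))" for k i j
  let ?A' = "mat ?p N (\<lambda>(k, i). a k i i / 2) @\<^sub>c
      mat ?p ?P (\<lambda>(k, l). case pairs_lt N ! l of (i, j) \<Rightarrow> a k i j + a k j i)"
  have A': "?A' \<in> carrier_mat ?p (N + ?P)" by (intro append_cols_carrier mat_carrier)
  have A_eq: "A_tilde n A = ?A' @\<^sub>c 0\<^sub>m ?p n"
    using A by (simp add: A_tilde_def Let_def append_cols_assoc a_def case_prod_unfold)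
  have constr: "A_tilde n A *\<^sub>v (?\<eta> @\<^sub>v \<delta>) = b_tilde A b"
  proof (intro eq_vecI)
    show dim: "dim_vec (A_tilde n A *\<^sub>v (?\<eta> @\<^sub>v \<delta>)) = dim_vec (b_tilde A b)"
      using A A' by (simp add: A_eq b_tilde_def append_cols_def)
    fix k assume "k < dim_vec (b_tilde A b)"
    then have k: "k < ?p" using A by (simp add: b_tilde_def)
    obtain r s where rs: "pairs_le nA ! k = (r, s)" "r < nA" "s < nA" using pairs_le_nth[OF k] by blast
    have "(\<Sum>i<N. \<Sum>j<N. a k i j * (\<xi> $ i * \<xi> $ j)) = (A *\<^sub>v \<xi>) $ r * (A *\<^sub>v \<xi>) $ s"
      using A \<xi>N rs by (simp add: a_def scalar_prod_def lessThan_atLeast0 sum_product ac_simps)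
    moreover have "(?A' *\<^sub>v ?\<eta>) $ k = (\<Sum>i<N. \<Sum>j<N. a k i j * (\<xi> $ i * \<xi> $ j)) - (\<Sum>i<N. a k i i) / 2"
      by (rule quad_vars_row[OF refl \<xi>N k])
    moreover have "A_tilde n A *\<^sub>v (?\<eta> @\<^sub>v \<delta>) = ?A' *\<^sub>v ?\<eta> + 0\<^sub>m ?p n *\<^sub>v \<delta>"
      unfolding A_eq by (rule append_cols_mult_vec[OF A' zero_carrier_mat \<eta> \<delta>(1)])
    moreover have "(0\<^sub>m ?p n *\<^sub>v \<delta>) $ k = 0" using k \<delta>(1) by simp
    ultimately show "(A_tilde n A *\<^sub>v (?\<eta> @\<^sub>v \<delta>)) $ k = b_tilde A b $ k"
      using k A by (simp add: A\<xi> b_tilde_def rs a_def)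
  qed
  have dim: "dim_col (A_tilde n A) = (N + ?P) + n"
    unfolding A_eq using carrier_matD[OF append_cols_carrier[OF A' zero_carrier_mat]] by simp
  have "?\<eta> @\<^sub>v \<delta> \<in> B_inf (A_tilde n A) (b_tilde A b)"
    unfolding B_inf_def dim
  proof (intro CollectI conjI allI impI constr append_carrier_vec \<eta> \<delta>(1))
    fix k assume k: "k < N + ?P + n"
    show "\<bar>(?\<eta> @\<^sub>v \<delta>) $ k\<bar> \<le> 1"
    proof (cases "k < N + ?P")
      case True
      then show ?thesis
        using quad_vars_bounded[OF \<xi>1, of N k] carrier_vecD[OF \<eta>] carrier_vecD[OF \<delta>(1)] by simp
    next
      case False
      then show ?thesis
        using \<delta>(2)[of "k - (N + ?P)"] k carrier_vecD[OF \<eta>] carrier_vecD[OF \<delta>(1)] by simp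
    qed
  qed
  then show ?thesis unfolding cz_set_def cz.sel point by (rule imageI)
qed

section \<open>The Taylor remainder\<close>

lemma quadratic_form_congruence:
  fixes G H :: "real mat"
  assumes G: "G \<in> carrier_mat n N" and H: "H \<in> carrier_mat n n" and \<xi>: "\<xi> \<in> carrier_vec N"
  shows "(\<Sum>i<N. \<Sum>j<N. (transpose_mat G * H * G) $$ (i, j) * (\<xi> $ i * \<xi> $ j)) =
    (\<Sum>i<n. \<Sum>j<n. H $$ (i, j) * ((G *\<^sub>v \<xi>) $ i * (G *\<^sub>v \<xi>) $ j))"
proof -
  have form: "(\<Sum>i<m. \<Sum>j<m. M $$ (i, j) * (x $ i * x $ j)) = scalar_prod x (M *\<^sub>v x)"
    if M: "M \<in> carrier_mat m m" and x: "x \<in> carrier_vec m" for M :: "real mat" and x m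
    using that by (simp add: scalar_prod_def lessThan_atLeast0 sum_distrib_left ac_simps)
  have w: "H *\<^sub>v (G *\<^sub>v \<xi>) \<in> carrier_vec n" using G H \<xi> by simp
  have "(transpose_mat G * H * G) *\<^sub>v \<xi> = transpose_mat G *\<^sub>v (H *\<^sub>v (G *\<^sub>v \<xi>))"
    using G H \<xi> assoc_mult_mat_vec[of "transpose_mat G" N n "H * G" N \<xi>]
      assoc_mult_mat_vec[OF H G \<xi>] by simp
  then have eq: "scalar_prod \<xi> ((transpose_mat G * H * G) *\<^sub>v \<xi>) = scalar_prod (G *\<^sub>v \<xi>) (H *\<^sub>v (G *\<^sub>v \<xi>))"
    using transpose_vec_mult_scalar[OF G \<xi> w] comm_scalar_prod[OF \<xi>, of "transpose_mat G *\<^sub>v (H *\<^sub>v (G *\<^sub>v \<xi>))"]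
      comm_scalar_prod[OF w, of "G *\<^sub>v \<xi>"] G w \<xi> by simp
  have "transpose_mat G * H * G \<in> carrier_mat N N" "G *\<^sub>v \<xi> \<in> carrier_vec n" using G H \<xi> by simp_all
  then show ?thesis using \<xi> H by (simp only: form eq)
qed

text \<open>The form \<open>d\<^sup>T H d\<close> at \<open>d = g + p\<close>. In \<open>p\<^sup>T H g + g\<^sup>T H p\<close> the matrix enters through its symmetric part
  only, and \<open>p\<^sup>T H p\<close> is unaffected by symmetrizing; so all terms that involve \<open>p\<close> combine into one row
  vector \<open>p\<^sup>T (H + H\<^sup>T) / 2\<close> applied to \<open>p + 2 g\<close>.\<close>

lemma cross_term:
  fixes H :: "nat \<Rightarrow> nat \<Rightarrow> real"
  shows "(\<Sum>i<n. \<Sum>j<n. H i j * ((g i + p i) * (g j + p j))) =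
    (\<Sum>i<n. \<Sum>j<n. H i j * (g i * g j)) +
    (\<Sum>k<n. (\<Sum>i<n. p i * ((H i k + H k i) / 2)) * (p k + 2 * g k))"
proof -
  have "(\<Sum>k<n. (\<Sum>i<n. p i * ((H i k + H k i) / 2)) * (p k + 2 * g k)) =
      (\<Sum>k<n. \<Sum>i<n. H i k * (p i * (p k + 2 * g k) / 2)) +
      (\<Sum>k<n. \<Sum>i<n. H k i * (p i * (p k + 2 * g k) / 2))"
    unfolding sum_distrib_right sum.distrib[symmetric]
    by (intro sum.cong refl) (simp add: field_simps)
  also have "(\<Sum>k<n. \<Sum>i<n. H i k * (p i * (p k + 2 * g k) / 2)) =
      (\<Sum>i<n. \<Sum>j<n. H i j * (p i * (p j + 2 * g j) / 2))"
    by (rule sum.swap)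
  finally have split: "(\<Sum>k<n. (\<Sum>i<n. p i * ((H i k + H k i) / 2)) * (p k + 2 * g k)) =
      (\<Sum>i<n. \<Sum>j<n. H i j * (p i * (p j + 2 * g j) / 2)) +
      (\<Sum>i<n. \<Sum>j<n. H i j * (p j * (p i + 2 * g i) / 2))" .
  show ?thesis
    unfolding split sum.distrib[symmetric] by (intro sum.cong refl) (simp add: field_simps)
qed

lemma shifted_cz_wf: "cz_wf n Z \<Longrightarrow> \<gamma> \<in> carrier_vec n \<Longrightarrow> cz_wf n (shifted_cz \<gamma> Z)"
  by (auto simp: cz_wf_def shifted_cz_def)

lemma remainder_cz_wf:
  assumes Z: "cz_wf n Z" and \<gamma>: "\<gamma> \<in> carrier_vec n" and L: "L \<in> carrier_mat n n"
  shows "cz_wf n (remainder_cz n Z \<gamma> Qt L Mb mv)"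
proof -
  obtain N where "cz_A Z \<in> carrier_mat (dim_row (cz_A Z)) N" "dim_col (cz_G Z) = N"
    using Z by (auto simp: cz_wf_def)
  then show ?thesis
    unfolding remainder_cz_def Let_def
    by (simp only:) (intro cz_sum_wf quadratic_part_wf cz_prod_wf L shifted_cz_wf Z \<gamma>)
qed

text \<open>The matrices \<open>H q\<close> may belong to different points of the interval hull for different \<open>q\<close>, as they do in
  Taylor's formula, since the Lagrange point depends on the component.\<close>

lemma remainder_cz_mem:
  assumes c: "c \<in> carrier_vec n" and G: "G \<in> carrier_mat n nG"
    and A: "A \<in> carrier_mat nA nG" and b: "b \<in> carrier_vec nA" and \<gamma>: "\<gamma> \<in> carrier_vec n"
    and L: "L \<in> carrier_mat n n" and \<xi>: "\<xi> \<in> B_inf A b"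
    and H: "\<And>q. q < n \<Longrightarrow> H q \<in> carrier_mat n n"
    and Qt: "\<And>q. q < n \<Longrightarrow> transpose_mat G * H q * G \<in> set_of_imat (Qt q)"
    and L_rows: "\<And>q. q < n \<Longrightarrow> mat_of_row (c - \<gamma>) * ((1/2) \<cdot>\<^sub>m (H q + transpose_mat (H q)))
         \<in> set_of_imat (mat_of_row (row L q))"
    and prod: "cz_prod_ok n L (shifted_cz \<gamma> (CZ c G A b)) cb Mb mv"
    and d: "d = G *\<^sub>v \<xi> + (c - \<gamma>)"
  shows "vec n (\<lambda>q. \<Sum>i<n. \<Sum>j<n. H q $$ (i, j) * (d $ i * d $ j)) \<in>
    cz_set (remainder_cz n (CZ c G A b) \<gamma> Qt L Mb mv)"
proof -
  have \<xi>n: "\<xi> \<in> carrier_vec nG" using \<xi> A by (auto simp: B_inf_def)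
  define p g where "p = c - \<gamma>" and "g = G *\<^sub>v \<xi>"
  have p: "p \<in> carrier_vec n" using c \<gamma> by (simp add: p_def)
  have g: "g \<in> carrier_vec n" using G \<xi>n by (simp add: g_def)
  have wf: "cz_wf n (CZ c G A b)" using c G A b by (simp add: cz_wf_def)
  let ?M = "\<lambda>q. transpose_mat G * H q * G"
  let ?u = "vec n (\<lambda>q. \<Sum>i<nG. \<Sum>j<nG. ?M q $$ (i, j) * (\<xi> $ i * \<xi> $ j))"
  have "?u \<in> cz_set (CZ (c_tilde n nG Qt) (G_tilde n nG Qt @\<^sub>c G_d_tilde n nG Qt) (A_tilde n A) (b_tilde A b))"
  proof (rule quadratic_part_mem[OF A b \<xi>])
    fix q i j assume q: "q < n" and ij: "i < nG" "j < nG"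
    have "?M q \<in> carrier_mat nG nG" using G H[OF q] by simp
    moreover have "?M q \<in> carrier_mat (dim_row (Qt q)) (dim_col (Qt q))"
      using Qt[OF q] by (simp only: set_of_imat_def mem_Collect_eq)
    ultimately have "dim_row (Qt q) = nG" "dim_col (Qt q) = nG" by (metis carrier_matD)+
    then show "?M q $$ (i, j) \<in> set_of (Qt q $$ (i, j))"
      using Qt[OF q] ij unfolding set_of_imat_def by simp
  qed
  moreover
  \<comment> \<open>Row \<open>q\<close> is \<open>p\<^sup>T (H q + (H q)\<^sup>T) / 2\<close>.\<close>
  define \<Lambda> where "\<Lambda> = mat n n (\<lambda>(q, k). \<Sum>i<n. p $ i * ((H q $$ (i, k) + H q $$ (k, i)) / 2))"
  have "\<Lambda> \<in> set_of_imat L"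
    unfolding set_of_imat_def carrier_matD[OF L]
  proof (intro CollectI conjI allI impI)
    show "\<Lambda> \<in> carrier_mat n n" by (simp add: \<Lambda>_def)
    fix q k assume q: "q < n" and k: "k < n"
    have "(mat_of_row p * ((1/2) \<cdot>\<^sub>m (H q + transpose_mat (H q)))) $$ (0, k) = \<Lambda> $$ (q, k)"
      using q k p H[OF q] by (simp add: \<Lambda>_def scalar_prod_def lessThan_atLeast0)
    moreover have "mat_of_row (row L q) $$ (0, k) = L $$ (q, k)"
      using q k L by simp
    ultimately show "\<Lambda> $$ (q, k) \<in> set_of (L $$ (q, k))"
      using L_rows[OF q] k L unfolding set_of_imat_def p_def[symmetric] by auto
  qed
  moreover
  define y where "y = p + 2 \<cdot>\<^sub>v g"
  have "y = (2 \<cdot>\<^sub>m G) *\<^sub>v \<xi> + p"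
    using p g G \<xi>n by (intro eq_vecI) (auto simp: y_def g_def)
  then have "y \<in> cz_set (shifted_cz \<gamma> (CZ c G A b))"
    using \<xi> by (simp add: cz_set_def shifted_cz_def p_def)
  ultimately have "?u + \<Lambda> *\<^sub>v y \<in> cz_set (remainder_cz n (CZ c G A b) \<gamma> Qt L Mb mv)"
    unfolding remainder_cz_def Let_def cz.sel carrier_matD[OF G]
    by (intro cz_sum_mem[of n] quadratic_part_wf[OF A] cz_prod_wf L shifted_cz_wf wf \<gamma> cz_prod_mem[OF prod])
  moreover have "?u + \<Lambda> *\<^sub>v y = vec n (\<lambda>q. \<Sum>i<n. \<Sum>j<n. H q $$ (i, j) * (d $ i * d $ j))"
  proof (intro eq_vecI)
    fix q assume "q < dim_vec (vec n (\<lambda>q. \<Sum>i<n. \<Sum>j<n. H q $$ (i, j) * (d $ i * d $ j)))"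
    then have q: "q < n" by simp
    have "(\<Lambda> *\<^sub>v y) $ q =
        (\<Sum>k<n. (\<Sum>i<n. p $ i * ((H q $$ (i, k) + H q $$ (k, i)) / 2)) * (p $ k + 2 * g $ k))"
      using q p g by (simp add: \<Lambda>_def y_def scalar_prod_def lessThan_atLeast0)
    moreover have "?u $ q = (\<Sum>i<n. \<Sum>j<n. H q $$ (i, j) * (g $ i * g $ j))"
      using q quadratic_form_congruence[OF G H[OF q] \<xi>n] by (simp add: g_def)
    moreover have "(\<Sum>i<n. \<Sum>j<n. H q $$ (i, j) * (d $ i * d $ j)) =
        (\<Sum>i<n. \<Sum>j<n. H q $$ (i, j) * ((g $ i + p $ i) * (g $ j + p $ j)))"
      using g p unfolding d g_def[symmetric] p_def[symmetric] by simp
    moreover have "dim_vec (\<Lambda> *\<^sub>v y) = n" by (simp add: \<Lambda>_def)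
    ultimately show "(?u + \<Lambda> *\<^sub>v y) $ q = vec n (\<lambda>q. \<Sum>i<n. \<Sum>j<n. H q $$ (i, j) * (d $ i * d $ j)) $ q"
      using q cross_term[of "\<lambda>i j. H q $$ (i, j)" "\<lambda>i. g $ i" "\<lambda>i. p $ i" n] by simp
  qed (simp add: \<Lambda>_def)
  ultimately show ?thesis by simp
qed

section \<open>The closed loop\<close>

lemma cl_piece_wf:
  assumes Z: "cz_wf n Z" and \<gamma>: "\<gamma> \<in> carrier_vec n" and f: "f \<gamma> \<in> carrier_vec n"
    and R: "cz_wf n R" and P: "extends (dim_col (cz_A Z)) m P" and Bd: "Bd \<in> carrier_mat n m"
    and F: "F = f_hat n f \<gamma> Z R" and J: "J = jacobian_mat n f \<gamma>"
  shows "cz_wf n (cl_piece n m Bd J Z R F P)"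
  using assms
  by (auto simp: cz_wf_def extends_def cl_piece_def f_hat_def Let_def append_cols_def block_diag_def
      jacobian_mat_def intro!: carrier_matI carrier_vecI)

text \<open>The vector \<open>(\<xi> @\<^sub>v \<omega>) @\<^sub>v \<eta>\<close> is feasible for the block diagonal constraints. The zero columns make \<open>J G\<close>
  act on \<open>\<xi>\<close> alone, \<open>GR\<close> on \<open>\<eta>\<close> alone and \<open>GP\<close> on \<open>\<xi> @\<^sub>v \<omega>\<close>; the linear part and the network output
  thus share \<open>\<xi>\<close>.\<close>

lemma cl_piece_mem:
  assumes c: "c \<in> carrier_vec n" and G: "G \<in> carrier_mat n nG" and A: "A \<in> carrier_mat nA nG"
    and \<xi>: "\<xi> \<in> B_inf A b" and \<gamma>: "\<gamma> \<in> carrier_vec n" and f: "f \<gamma> \<in> carrier_vec n"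
    and R: "cz_wf n R" and P: "extends nG m P" and Bd: "Bd \<in> carrier_mat n m"
    and Z: "Z = CZ c G A b" and F: "F = f_hat n f \<gamma> Z R" and J: "J = jacobian_mat n f \<gamma>"
    and r: "r \<in> cz_set R" and u: "lifts \<xi> u P"
  shows "f \<gamma> + J *\<^sub>v (G *\<^sub>v \<xi> + (c - \<gamma>)) + r + Bd *\<^sub>v u \<in> cz_set (cl_piece n m Bd J Z R F P)"
proof -
  obtain cR GR AR bR where R_eq: "R = CZ cR GR AR bR" by (cases R)
  obtain cP GP AP bP where P_eq: "P = CZ cP GP AP bP" by (cases P)
  define K N where "K = dim_col AR" and "N = dim_col AP"
  have cR: "cR \<in> carrier_vec n" and GR: "GR \<in> carrier_mat n K"
    using R by (auto simp: R_eq cz_wf_def K_def)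
  have cP: "cP \<in> carrier_vec m" and GP: "GP \<in> carrier_mat m N" and N: "nG \<le> N"
    using P by (auto simp: P_eq cz_wf_def extends_def N_def)
  have Jn: "J \<in> carrier_mat n n" by (simp add: J jacobian_mat_def)
  obtain \<omega> where \<omega>: "\<xi> @\<^sub>v \<omega> \<in> B_inf AP bP" "u = GP *\<^sub>v (\<xi> @\<^sub>v \<omega>) + cP"
    using u by (auto simp: lifts_def P_eq)
  obtain \<eta> where \<eta>: "\<eta> \<in> B_inf AR bR" "r = GR *\<^sub>v \<eta> + cR"
    using r by (auto simp: cz_set_def R_eq)
  have \<xi>c: "\<xi> \<in> carrier_vec nG" using \<xi> A by (auto simp: B_inf_def)
  have \<zeta>c: "\<xi> @\<^sub>v \<omega> \<in> carrier_vec N" using \<omega>(1) by (auto simp: B_inf_def N_def)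
  then have \<omega>c: "\<omega> \<in> carrier_vec (N - nG)"
    using \<xi>c by (intro carrier_vecI) (auto dest!: carrier_vecD)
  have \<eta>c: "\<eta> \<in> carrier_vec K" using \<eta>(1) by (auto simp: B_inf_def K_def)
  let ?X = "(J * G) @\<^sub>c 0\<^sub>m n (N - nG) @\<^sub>c GR" and ?Y = "GP @\<^sub>c 0\<^sub>m m K"
  have JG: "J * G \<in> carrier_mat n nG" using Jn G by simp
  have X: "?X \<in> carrier_mat n (nG + ((N - nG) + K))"
    using JG GR by (intro append_cols_carrier) auto
  have X': "?X \<in> carrier_mat n (N + K)" using X N by simp
  have Y: "?Y \<in> carrier_mat m (N + K)" using GP by (intro append_cols_carrier) auto
  have e: "(\<xi> @\<^sub>v \<omega>) @\<^sub>v \<eta> \<in> carrier_vec (N + K)" using \<zeta>c \<eta>c by (rule append_carrier_vec)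
  have FG: "dim_col (cz_G F) - nG = K"
    using carrier_matD[OF append_cols_carrier[OF JG GR]] by (simp add: F f_hat_def Z R_eq J)
  have cl: "cl_piece n m Bd J Z R F P =
      CZ (cz_c F + Bd *\<^sub>v cP) (?X + Bd * ?Y) (block_diag AP AR) (bP @\<^sub>v bR)"
    unfolding cl_piece_def Let_def FG[symmetric]
    using carrier_matD[OF G] carrier_matD[OF GP] by (simp add: Z P_eq R_eq)
  have "?X *\<^sub>v ((\<xi> @\<^sub>v \<omega>) @\<^sub>v \<eta>) = (J * G) *\<^sub>v \<xi> + GR *\<^sub>v \<eta>"
  proof -
    have "?X *\<^sub>v ((\<xi> @\<^sub>v \<omega>) @\<^sub>v \<eta>) = (J * G) *\<^sub>v \<xi> + (0\<^sub>m n (N - nG) *\<^sub>v \<omega> + GR *\<^sub>v \<eta>)"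
      unfolding append_vec_assoc
      by (subst append_cols_mult_vec[OF JG append_cols_carrier[OF zero_carrier_mat GR] \<xi>c
            append_carrier_vec[OF \<omega>c \<eta>c]],
          subst append_cols_mult_vec[OF zero_carrier_mat GR \<omega>c \<eta>c], rule refl)
    also have "0\<^sub>m n (N - nG) *\<^sub>v \<omega> + GR *\<^sub>v \<eta> = GR *\<^sub>v \<eta>"
      using GR \<omega>c \<eta>c by (intro eq_vecI) auto
    finally show ?thesis .
  qed
  moreover have "?Y *\<^sub>v ((\<xi> @\<^sub>v \<omega>) @\<^sub>v \<eta>) = GP *\<^sub>v (\<xi> @\<^sub>v \<omega>)"
  proof -
    have "?Y *\<^sub>v ((\<xi> @\<^sub>v \<omega>) @\<^sub>v \<eta>) = GP *\<^sub>v (\<xi> @\<^sub>v \<omega>) + 0\<^sub>m m K *\<^sub>v \<eta>"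
      by (rule append_cols_mult_vec[OF GP zero_carrier_mat \<zeta>c \<eta>c])
    also have "\<dots> = GP *\<^sub>v (\<xi> @\<^sub>v \<omega>)"
      using GP \<eta>c by (intro eq_vecI) auto
    finally show ?thesis .
  qed
  ultimately have gens: "(?X + Bd * ?Y) *\<^sub>v ((\<xi> @\<^sub>v \<omega>) @\<^sub>v \<eta>) =
      (J *\<^sub>v (G *\<^sub>v \<xi>) + GR *\<^sub>v \<eta>) + Bd *\<^sub>v (GP *\<^sub>v (\<xi> @\<^sub>v \<omega>))"
    by (simp add: add_mult_distrib_mat_vec[OF X' mult_carrier_mat[OF Bd Y] e]
        assoc_mult_mat_vec[OF Bd Y e] assoc_mult_mat_vec[OF Jn G \<xi>c])
  have "f \<gamma> + J *\<^sub>v (G *\<^sub>v \<xi> + (c - \<gamma>)) + r + Bd *\<^sub>v u =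
      (?X + Bd * ?Y) *\<^sub>v ((\<xi> @\<^sub>v \<omega>) @\<^sub>v \<eta>) + (cz_c F + Bd *\<^sub>v cP)"
  proof -
    have "J *\<^sub>v (G *\<^sub>v \<xi> + (c - \<gamma>)) = J *\<^sub>v (G *\<^sub>v \<xi>) + J *\<^sub>v (c - \<gamma>)"
      using G \<xi>c c \<gamma> by (intro mult_add_distrib_mat_vec[OF Jn]) auto
    moreover have "Bd *\<^sub>v u = Bd *\<^sub>v (GP *\<^sub>v (\<xi> @\<^sub>v \<omega>)) + Bd *\<^sub>v cP"
      unfolding \<omega>(2) using GP \<zeta>c cP by (intro mult_add_distrib_mat_vec[OF Bd]) auto
    moreover have "cz_c F = J *\<^sub>v (c - \<gamma>) + f \<gamma> + cR"
      by (simp add: F f_hat_def Z R_eq J)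
    moreover define a1 a2 a3 a4 a5 where "a1 = J *\<^sub>v (G *\<^sub>v \<xi>)" and "a2 = J *\<^sub>v (c - \<gamma>)"
      and "a3 = Bd *\<^sub>v (GP *\<^sub>v (\<xi> @\<^sub>v \<omega>))" and "a4 = Bd *\<^sub>v cP" and "a5 = GR *\<^sub>v \<eta>"
    moreover have "a1 \<in> carrier_vec n" "a2 \<in> carrier_vec n" "a3 \<in> carrier_vec n" "a4 \<in> carrier_vec n"
      "a5 \<in> carrier_vec n"
      unfolding a1_def a2_def a3_def a4_def a5_def
      using Jn Bd GR by (auto intro!: carrier_vecI)
    ultimately show ?thesis
      unfolding gens \<eta>(2) using f cR
      by (simp only:) (intro eq_vecI; simp)
  qed
  then show ?thesis
    unfolding cl cz_set_def cz.sel using B_inf_append[OF \<omega>(1) \<eta>(1)] by (intro image_eqI)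
qed

theorem theorem3:
  fixes n m ell nG nA :: nat
    and f :: "real vec \<Rightarrow> real vec" and Bd :: "real mat"
    and W :: "nat \<Rightarrow> real mat" and v :: "nat \<Rightarrow> real vec"
    and c b \<gamma> cb :: "real vec" and G A Mb :: "real mat"
    and Q Qt :: "nat \<Rightarrow> real interval mat" and L :: "real interval mat" and mv :: "real interval vec"
  assumes f_maps: "f \<in> carrier_vec n \<rightarrow> carrier_vec n"
    and f_C2: "\<And>q. q < n \<Longrightarrow> class_C 2 n (\<lambda>x. f x $ q)"
    and Bd: "Bd \<in> carrier_mat n m"
    and net: "nn_wf n m ell W v"
    and c: "c \<in> carrier_vec n" and G: "G \<in> carrier_mat n nG"
    and A: "A \<in> carrier_mat nA nG" and b: "b \<in> carrier_vec nA"
    and \<gamma>: "\<gamma> \<in> interval_hull n (cz_set (CZ c G A b))"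
    and Q: "\<And>q. q < n \<Longrightarrow> Q q \<in> carrier_mat n n"
      "\<And>q x. q < n \<Longrightarrow> x \<in> interval_hull n (cz_set (CZ c G A b)) \<Longrightarrow>
         half_hessian n f q x \<in> set_of_imat (Q q)"
    and Qt: "\<And>q. q < n \<Longrightarrow> imat_of (transpose_mat G) *\<^sub>i Q q *\<^sub>i imat_of G \<le> Qt q"
    and L: "L \<in> carrier_mat n n"
      "\<And>q. q < n \<Longrightarrow> imat_of (mat_of_row (c - \<gamma>)) *\<^sub>i Q q \<le> mat_of_row (row L q)"
    and L_sym: "\<And>q x. q < n \<Longrightarrow> x \<in> interval_hull n (cz_set (CZ c G A b)) \<Longrightarrow>
         mat_of_row (c - \<gamma>) *
           ((1/2) \<cdot>\<^sub>m (half_hessian n f q x + transpose_mat (half_hessian n f q x)))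
         \<in> set_of_imat (mat_of_row (row L q))"
    and prod: "cz_prod_ok n L (shifted_cz \<gamma> (CZ c G A b)) cb Mb mv"
  shows "let Z = CZ c G A b;
             R = remainder_cz n Z \<gamma> Qt L Mb mv;
             F = f_hat n f \<gamma> Z R;
             cl = cl_piece n m Bd (jacobian_mat n f \<gamma>) Z R F;
             Ps = exact_output ell W v Z
         in (\<forall>i<length Ps. cz_wf n (cl (Ps ! i))) \<and>
            (\<lambda>x. f x + Bd *\<^sub>v nn ell W v x) ` cz_set Z \<subseteq> (\<Union>i<length Ps. cz_set (cl (Ps ! i)))"
proof -
  define Z R F J Ps where Z: "Z = CZ c G A b" and R: "R = remainder_cz n Z \<gamma> Qt L Mb mv"
    and F: "F = f_hat n f \<gamma> Z R" and J: "J = jacobian_mat n f \<gamma>" and Ps: "Ps = exact_output ell W v Z"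
  let ?S = "cz_set (CZ c G A b)"
  have wf: "cz_wf n Z" using c G A b by (simp add: cz_wf_def Z)
  have ext: "extends nG n Z" using wf A by (simp add: extends_def Z)
  obtain l u where "?S \<subseteq> {l..u}" "l \<in> carrier_vec n" "u \<in> carrier_vec n"
    using cz_set_bounded[OF wf] unfolding Z by blast
  note hull_carrier = interval_hull_carrier[OF this]
  have \<gamma>n: "\<gamma> \<in> carrier_vec n" by (rule hull_carrier[OF \<gamma>])
  have f\<gamma>: "f \<gamma> \<in> carrier_vec n" using f_maps \<gamma>n by auto
  have Rwf: "cz_wf n R" unfolding R by (rule remainder_cz_wf[OF wf \<gamma>n L(1)])
  have Ps_ext: "extends nG m P" if "P \<in> set Ps" for P
    using exact_output_extends[OF net ext] that unfolding Ps by blast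
  have "cz_wf n (cl_piece n m Bd J Z R F P)" if "P \<in> set Ps" for P
    using Ps_ext[OF that] A by (intro cl_piece_wf[OF wf \<gamma>n f\<gamma> Rwf _ Bd F J]) (simp add: Z)
  moreover have "\<exists>P \<in> set Ps. f x + Bd *\<^sub>v nn ell W v x \<in> cz_set (cl_piece n m Bd J Z R F P)"
    if x: "x \<in> cz_set Z" for x
  proof -
    obtain \<xi> where \<xi>: "\<xi> \<in> B_inf A b" and x\<xi>: "x = G *\<^sub>v \<xi> + c"
      using x by (auto simp: cz_set_def Z)
    have \<xi>n: "\<xi> \<in> carrier_vec nG" using \<xi> A by (auto simp: B_inf_def)
    have x_hull: "x \<in> interval_hull n ?S" using x interval_hull_superset unfolding Z by blast
    then have xn: "x \<in> carrier_vec n" by (rule hull_carrier)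
    define d where "d = x - \<gamma>"
    have d: "d = G *\<^sub>v \<xi> + (c - \<gamma>)"
      using G \<xi>n c \<gamma>n by (intro eq_vecI) (auto simp: d_def x\<xi>)
    have dn: "d \<in> carrier_vec n" unfolding d_def by (rule minus_carrier_vec[OF xn \<gamma>n])
    have x_eq: "\<gamma> + d = x" using xn \<gamma>n by (intro eq_vecI) (auto simp: d_def)
    \<comment> \<open>The Lagrange point is a function of the component \<open>q\<close>.\<close>
    define T where "T q s \<longleftrightarrow> 0 \<le> s \<and> s \<le> 1 \<and> f x $ q = f \<gamma> $ q + (J *\<^sub>v d) $ q +
        (\<Sum>i<n. \<Sum>j<n. half_hessian n f q (\<gamma> + s \<cdot>\<^sub>v d) $$ (i, j) * (d $ i * d $ j))" for q s
    have "\<exists>s. T q s" if "q < n" for q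
      using taylor_half_hessian[OF f_C2[OF that] that \<gamma>n dn] unfolding J x_eq T_def .
    then obtain t where T: "\<And>q. q < n \<Longrightarrow> T q (t q)" by metis
    note t = T[unfolded T_def]
    define H where "H q = half_hessian n f q (\<gamma> + t q \<cdot>\<^sub>v d)" for q
    have hull: "\<gamma> + t q \<cdot>\<^sub>v d \<in> interval_hull n ?S" if "q < n" for q
      unfolding d_def using t[OF that] by (intro interval_hull_segment \<gamma> \<gamma>n x_hull xn) auto
    have Hn: "H q \<in> carrier_mat n n" for q by (simp add: H_def half_hessian_def)
    define r where "r = vec n (\<lambda>q. \<Sum>i<n. \<Sum>j<n. H q $$ (i, j) * (d $ i * d $ j))"
    have "r \<in> cz_set R"
      unfolding r_def R Z
    proof (rule remainder_cz_mem[OF c G A b \<gamma>n L(1) \<xi> Hn _ _ prod d])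
      fix q assume q: "q < n"
      show "transpose_mat G * H q * G \<in> set_of_imat (Qt q)"
        using Q(1)[OF q] G Q(2)[OF q hull[OF q]] unfolding H_def
        by (intro set_of_imat_mono[OF Qt[OF q]] imat_mult_mem imat_of_mem)
          (simp_all add: imat_mult_def)
      show "mat_of_row (c - \<gamma>) * ((1/2) \<cdot>\<^sub>m (H q + transpose_mat (H q))) \<in> set_of_imat (mat_of_row (row L q))"
        unfolding H_def by (rule L_sym[OF q hull[OF q]])
    qed
    moreover have "lifts \<xi> x Z" unfolding x\<xi> Z by (rule lifts_self[OF \<xi>])
    then obtain P where P: "P \<in> set Ps" "lifts \<xi> (nn ell W v x) P"
      using exact_output_lifts[OF net wf] unfolding Ps by blast
    ultimately have "f \<gamma> + J *\<^sub>v (G *\<^sub>v \<xi> + (c - \<gamma>)) + r + Bd *\<^sub>v nn ell W v x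
        \<in> cz_set (cl_piece n m Bd J Z R F P)"
      by (intro cl_piece_mem[OF c G A \<xi> \<gamma>n f\<gamma> Rwf Ps_ext Bd Z F J])
    moreover have "f \<gamma> + J *\<^sub>v (G *\<^sub>v \<xi> + (c - \<gamma>)) + r = f x"
    proof (intro eq_vecI)
      have fx: "f x \<in> carrier_vec n" using f_maps xn by auto
      then show "dim_vec (f \<gamma> + J *\<^sub>v (G *\<^sub>v \<xi> + (c - \<gamma>)) + r) = dim_vec (f x)"
        by (simp add: r_def)
      fix q assume "q < dim_vec (f x)"
      then have q: "q < n" using fx by simp
      show "(f \<gamma> + J *\<^sub>v (G *\<^sub>v \<xi> + (c - \<gamma>)) + r) $ q = f x $ q"
        unfolding d[symmetric] using t[OF q] q by (simp add: r_def H_def J jacobian_mat_def)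
    qed
    ultimately show ?thesis using P(1) by auto
  qed
  ultimately show ?thesis
    unfolding Let_def Z[symmetric] R[symmetric] F[symmetric] J[symmetric] Ps[symmetric]
    by (fastforce simp: in_set_conv_nth)
qed

end
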